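(* Let $d\ge 2$ and let $0<s<1/2$. Then there exists a Borel set $E\subseteq\mathbb{R}^d$ such that $\dim_{\mathrm H} D(E)<1$ and $\dim_{\mathrm F}^{\theta}E\ge\dim_{\mathrm F}E\ge s$ for all $\theta\in[0,1]$.
   Context: $D(E)=\{|x-y|:x,y\in E\}$; $\dim_{\mathrm H}$ is Hausdorff dimension. For a finite Borel measure $\mu$ on $\mathbb{R}^d$, $\widehat\mu(z)=\int e^{-2\pi i z\cdot x}\,d\mu(x)$. For $s\ge 0$ define $$\mathcal{J}_{s,\theta}(\mu)=\left(\int_{\mathbb{R}^d}|\widehat\mu(z)|^{2/\theta}|z|^{s/\theta-d}\,dz\right)^{\theta}\ (\theta\in(0,1]),\qquad \mathcal{J}_{s,0}(\mu)=\sup_{z\in\mathbb{R}^d}|\widehat\mu(z)|^2|z|^s.$$ The Fourier spectrum of $\mu$ at $\theta\in[0,1]$ is $\dim_{\mathrm F}^{\theta}\mu=\sup\{s\ge 0:\mathcal{J}_{s,\theta}(\mu)<\infty\}$ (with $\sup\emptyset=0$). For a Borel set $E\subseteq\mathbb{R}^d$, $\dim_{\mathrm F}^{\theta}E=\sup\{\min\{\dim_{\mathrm F}^{\theta}\mu,d\}:\mu\in\mathcal{M}(E)\}$, where $\mathcal{M}(E)$ is the set of finite, non-zero Borel measures with support contained in $E$. The Fourier dimension of $E$ is $\dim_{\mathrm F}E=\dim_{\mathrm F}^{0}E$. *)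

theory Defs
  imports "HOL-Analysis.Analysis"
begin

(* All dimensions are valued in ennreal, where Sup {} = 0 and Inf {} = top. *)

definition distance_set :: "'a::metric_space set \<Rightarrow> real set" where
  "distance_set E = {dist x y | x y. x \<in> E \<and> y \<in> E}"

(* Real powers of a nonnegative base with 0^0 = 1 (the library has 0 powr 0 = 0). *)
definition rpow :: "real \<Rightarrow> real \<Rightarrow> real" where
  "rpow r s = (if s = 0 then 1 else r powr s)"

(* For exponents p > 0 only, so that the value at top is top and the value at 0 is 0. *)
definition ennreal_powr :: "ennreal \<Rightarrow> real \<Rightarrow> ennreal" where
  "ennreal_powr x p = (if x = top then top else ennreal (enn2real x powr p))"


subsection \<open>Hausdorff dimension\<close>

(* The empty set has gauge 0 also for s = 0, while singletons then have gauge 1. *)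
definition diam_pow :: "real \<Rightarrow> 'a::metric_space set \<Rightarrow> ennreal" where
  "diam_pow s U = (if U = {} then 0 else ennreal (rpow (diameter U) s))"

(* Boundedness is required because diameter is unspecified on unbounded sets. *)
definition hausdorff_premeasure :: "real \<Rightarrow> real \<Rightarrow> 'a::metric_space set \<Rightarrow> ennreal" where
  "hausdorff_premeasure s \<delta> A =
     Inf {(\<Sum>i. diam_pow s (U i)) | U :: nat \<Rightarrow> 'a set.
            A \<subseteq> (\<Union>i. U i) \<and> (\<forall>i. bounded (U i) \<and> diameter (U i) \<le> \<delta>)}"

definition hausdorff_measure :: "real \<Rightarrow> 'a::metric_space set \<Rightarrow> ennreal" where
  "hausdorff_measure s A = (SUP \<delta>\<in>{0<..}. hausdorff_premeasure s \<delta> A)"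

definition hausdorff_dim :: "'a::metric_space set \<Rightarrow> ennreal" where
  "hausdorff_dim A = Inf (ennreal ` {s. 0 \<le> s \<and> hausdorff_measure s A = 0})"


subsection \<open>Fourier spectrum and Fourier dimension\<close>

definition fourier_transform :: "'a::euclidean_space measure \<Rightarrow> 'a \<Rightarrow> complex" where
  "fourier_transform \<mu> z =
     (LINT x|\<mu>. exp (- 2 * complex_of_real pi * \<i> * complex_of_real (z \<bullet> x)))"

(* In the case \<theta> > 0 the value of the integrand at z = 0 is irrelevant. *)
definition fourier_energy :: "real \<Rightarrow> real \<Rightarrow> 'a::euclidean_space measure \<Rightarrow> ennreal" where
  "fourier_energy s \<theta> \<mu> =
     (if \<theta> = 0
      then (SUP z. ennreal ((cmod (fourier_transform \<mu> z))\<^sup>2 * rpow (norm z) s))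
      else ennreal_powr
        (\<integral>\<^sup>+ z. ennreal (cmod (fourier_transform \<mu> z) powr (2 / \<theta>)
                      * norm z powr (s / \<theta> - real DIM('a))) \<partial>lborel) \<theta>)"

definition fourier_spectrum_measure :: "real \<Rightarrow> 'a::euclidean_space measure \<Rightarrow> ennreal" where
  "fourier_spectrum_measure \<theta> \<mu> = Sup (ennreal ` {s. 0 \<le> s \<and> fourier_energy s \<theta> \<mu> < top})"

(* The topological (closed) support. *)
definition measure_support :: "'a::topological_space measure \<Rightarrow> 'a set" where
  "measure_support \<mu> = {x. \<forall>U. open U \<and> x \<in> U \<longrightarrow> emeasure \<mu> U > 0}"

definition measures_on :: "'a::topological_space set \<Rightarrow> 'a measure set" where
  "measures_on E = {\<mu>. sets \<mu> = sets borel \<and> finite_measure \<mu> \<and> emeasure \<mu> UNIV \<noteq> 0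
                      \<and> measure_support \<mu> \<subseteq> E}"

definition fourier_spectrum :: "real \<Rightarrow> 'a::euclidean_space set \<Rightarrow> ennreal" where
  "fourier_spectrum \<theta> E =
     (SUP \<mu>\<in>measures_on E. min (fourier_spectrum_measure \<theta> \<mu>) (of_nat DIM('a)))"

definition fourier_dim :: "'a::euclidean_space set \<Rightarrow> ennreal" where
  "fourier_dim E = fourier_spectrum 0 E"

end

theory Submission
  imports Defs "HOL-Probability.Probability" "HOL-Real_Asymp.Real_Asymp"
begin

text \<open>
  There are two independent parts.

  For every set \<open>E\<close> the Fourier spectrum is at least the Fourier dimension: if
  \<open>|\<mu>^(z)|\<^sup>2 |z|\<^sup>s\<close> is bounded, then for \<open>0 < t < s\<close> the integrand of the energy at exponent \<open>t\<close> is
  bounded by a multiple of \<open>|z|\<close> to the power \<open>t/\<theta> - d\<close> near the origin and of \<open>(t-s)/\<theta> - d\<close> far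
  from it, and both are integrable (\<open>fourier_dim_le_fourier_spectrum\<close>).

  It remains to find a closed set \<open>E\<close> of Fourier dimension at least \<open>s\<close> that, at a sequence of
  scales \<open>1/T\<^sub>k\<close>, is covered by at most \<open>T\<^sub>k\<close> to the power \<open>t\<close> balls of radius about \<open>1/T\<^sub>k\<close>, for some
  \<open>s < t < 1/2\<close>. The distances between pairs of balls then cover \<open>D(E)\<close> by the square of that many
  intervals, so \<open>D(E)\<close> has dimension at most \<open>2t < 1\<close>; covers at a sequence of scales suffice for
  Hausdorff dimension.

  The set is a sparse Cantor set: it carries the law \<open>\<mu>\<close> of a random series \<open>\<Sum>k. X\<^sub>k\<close>, where \<open>X\<^sub>k\<close> is
  uniformly distributed on finitely many points of the ball of radius \<open>1/T\<^sub>k\<close> and the \<open>X\<^sub>k\<close> are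
  independent. As \<open>\<mu>^\<close> is the product of the transforms of the \<open>X\<^sub>k\<close>, it is enough that for every
  frequency a single factor is small (\<open>norm_fourier_transform_law_le\<close>); the \<open>k\<close>-th factor takes care
  of \<open>|z|\<close> between \<open>T\<^sub>k\<close> and \<open>T\<^sub>k\<^sub>+\<^sub>1\<close>, both to a power \<open>a\<close> slightly larger than 1. A sample of \<open>N\<close>
  points of a smooth distribution on the unit ball has a transform that deviates from the rapidly
  decaying transform of the distribution by about the square root of \<open>(log N)/N\<close>, simultaneously for
  all frequencies up to a power of \<open>N\<close> (\<open>exists_decaying_sample\<close>). With \<open>N\<close> about \<open>T\<^sub>k\<^sub>+\<^sub>1\<close> to a power
  between \<open>s\<close> and \<open>t\<close> this gives the decay, and if \<open>T\<^sub>k\<close> grows fast enough, then the product of the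
  numbers of points up to stage \<open>k\<close> is governed by its last factor.
\<close>

section \<open>Characters and products of independent variables\<close>

definition wave :: "'a::euclidean_space \<Rightarrow> 'a \<Rightarrow> complex" where
  "wave z x = exp (- 2 * complex_of_real pi * \<i> * complex_of_real (z \<bullet> x))"

lemma fourier_transform_eq_wave: "fourier_transform \<mu> z = (LINT x|\<mu>. wave z x)"
  by (simp add: fourier_transform_def wave_def)

lemma wave_eq_cis: "wave z x = cis (- 2 * pi * (z \<bullet> x))"
  by (simp add: wave_def cis_conv_exp mult_ac)

lemma norm_wave [simp]: "norm (wave z x) = 1"
  by (simp add: wave_eq_cis)

lemma wave_add: "wave z (x + y) = wave z x * wave z y"
  by (simp add: wave_eq_cis cis_mult inner_add_right algebra_simps)

lemma wave_zero_right [simp]: "wave z 0 = 1"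
  by (simp add: wave_eq_cis)

lemma wave_sum: "wave z (\<Sum>i\<in>I. f i) = (\<Prod>i\<in>I. wave z (f i))"
  by (induction I rule: infinite_finite_induct) (simp_all add: wave_add)

lemma wave_scaleR: "wave z (c *\<^sub>R x) = wave (c *\<^sub>R z) x"
  by (simp add: wave_eq_cis)

lemma continuous_wave [continuous_intros]:
  "continuous_on S f \<Longrightarrow> continuous_on S (\<lambda>x. wave z (f x))"
  unfolding wave_def by (intro continuous_intros)

lemma borel_measurable_wave [measurable]:
  assumes "f \<in> borel_measurable M" shows "(\<lambda>x. wave z (f x)) \<in> borel_measurable M"
proof -
  have "wave z \<in> borel_measurable borel"
    by (intro borel_measurable_continuous_onI continuous_intros)
  with assms show ?thesis by (rule measurable_compose)
qed

text \<open>
  This replaces the continuum of frequencies by a finite net, at a cost that is uniform over bounded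
  points \<open>x\<close>.
\<close>

lemma wave_lipschitz: "norm (wave z x - wave w x) \<le> 2 * pi * norm (z - w) * norm x"
proof -
  have "norm (cis a - cis b) \<le> \<bar>a - b\<bar>" for a b :: real
  proof -
    have "(norm (cis a - cis b))\<^sup>2 = (cos a - cos b)\<^sup>2 + (sin a - sin b)\<^sup>2"
      by (simp add: cmod_power2)
    also have "\<dots> = (2 * sin ((a - b)/2))\<^sup>2"
    proof -
      have two_half: "2 * ((a - b)/2) = a - b" by simp
      have "(cos a - cos b)\<^sup>2 + (sin a - sin b)\<^sup>2 = 
          ((sin a)\<^sup>2 + (cos a)\<^sup>2) + ((sin b)\<^sup>2 + (cos b)\<^sup>2) - 2 * cos (2 * ((a - b)/2))"
        by (simp only: two_half) (simp add: cos_diff power2_eq_square algebra_simps)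
      also have "\<dots> = 2 - 2 * cos (2 * ((a - b)/2))"
          by (simp only: sin_cos_squared_add)
      also have "\<dots> = (2 * sin ((a - b)/2))\<^sup>2"
        by (subst cos_double_sin) (simp add: power2_eq_square)
      finally show ?thesis .
    qed
    finally have "norm (cis a - cis b) = \<bar>2 * sin ((a - b)/2)\<bar>"
      by (metis norm_ge_zero power2_eq_iff_nonneg abs_ge_zero power2_abs)
    also have "\<dots> \<le> \<bar>a - b\<bar>"
      using abs_sin_le_one abs_sin_x_le_abs_x[of "(a-b)/2"] by (simp add: abs_mult)
    finally show ?thesis .
  qed
  then have "norm (wave z x - wave w x) \<le> \<bar>- 2 * pi * (z \<bullet> x) - - 2 * pi * (w \<bullet> x)\<bar>"
    by (simp only: wave_eq_cis)
  also have "\<dots> = 2 * pi * \<bar>(z - w) \<bullet> x\<bar>"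
    by (simp add: inner_diff_left abs_mult flip: right_diff_distrib)
  also have "\<dots> \<le> 2 * pi * (norm (z - w) * norm x)"
    by (intro mult_left_mono Cauchy_Schwarz_ineq2) auto
  finally show ?thesis by (simp add: mult_ac)
qed

lemma (in prob_space) integrable_wave [simp]:
  "f \<in> borel_measurable M \<Longrightarrow> integrable M (\<lambda>x. wave z (f x))"
  by (rule integrable_const_bound[where B = 1]) auto

lemma (in prob_space) norm_expectation_wave_le_1:
  "norm (LINT x|M. wave z (f x)) \<le> 1"
proof (cases "integrable M (\<lambda>x. wave z (f x))")
  case True
  have "norm (LINT x|M. wave z (f x)) \<le> (LINT x|M. norm (wave z (f x)))"
    by (rule integral_norm_bound)
  then show ?thesis by (simp add: prob_space)
next
  case False
  then show ?thesis by (simp add: not_integrable_integral_eq)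
qed

text \<open>
  The index set \<open>I\<close> may be infinite: only the finitely many coordinates in \<open>J\<close> enter, so Fubini on the
  marginal distribution of these coordinates applies.
\<close>

lemma (in product_prob_space) expectation_wave_sum:
  fixes f :: "'i \<Rightarrow> 'a \<Rightarrow> 'v::euclidean_space"
  assumes J: "finite J" "J \<subseteq> I"
    and f: "\<And>i. i \<in> J \<Longrightarrow> f i \<in> borel_measurable (M i)"
  shows "(LINT \<omega>|PiM I M. wave z (\<Sum>i\<in>J. f i (\<omega> i))) = (\<Prod>i\<in>J. LINT x|M i. wave z (f i x))"
proof -
  let ?g = "\<lambda>\<omega>. \<Prod>i\<in>J. wave z (f i (\<omega> i))"
  have meas: "?g \<in> borel_measurable (PiM J M)"
    using f by measurable
  have "(LINT \<omega>|PiM I M. wave z (\<Sum>i\<in>J. f i (\<omega> i))) = (LINT \<omega>|PiM I M. ?g (restrict \<omega> J))"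
    by (intro Bochner_Integration.integral_cong) (auto simp: wave_sum)
  also have "\<dots> = (LINT \<omega>|distr (PiM I M) (PiM J M) (\<lambda>\<omega>. restrict \<omega> J). ?g \<omega>)"
    by (rule integral_distr[symmetric]) (use J meas in \<open>simp_all only: measurable_restrict_subset\<close>)
  also have "\<dots> = (LINT \<omega>|PiM J M. ?g \<omega>)"
    using J by (simp add: distr_PiM_restrict_finite)
  also have "\<dots> = (\<Prod>i\<in>J. LINT x|M i. wave z (f i x))"
    by (rule product_integral_prod) (use J f in \<open>auto intro: M.integrable_wave\<close>)
  finally show ?thesis .
qed

section \<open>A smooth distribution on the unit ball\<close>

text \<open>
  A translation by half a period in the direction of \<open>z\<close> changes the sign of \<open>wave z\<close>. This is what
  produces cancellation for indicator functions of sets with a small boundary.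
\<close>

lemma wave_half_period:
  assumes "z \<noteq> 0"
  shows "wave z ((1 / (2 * (norm z)\<^sup>2)) *\<^sub>R z) = - 1"
proof -
  have "z \<bullet> ((1 / (2 * (norm z)\<^sup>2)) *\<^sub>R z) = 1/2"
    using assms by (simp add: dot_square_norm)
  then show ?thesis
    by (simp add: wave_eq_cis complex_eq_iff)
qed

text \<open>
  The two balls share a ball of radius \<open>1 - norm h\<close> around \<open>h\<close>, whose relative volume is estimated by
  Bernoulli's inequality.
\<close>

lemma content_symmetric_difference_ball:
  fixes h :: "'a::euclidean_space"
  assumes "norm h \<le> 1"
  shows "(LINT x|lborel. \<bar>indicator (ball 0 1) x - indicator (ball h 1) x\<bar>)
           \<le> 2 * real DIM('a) * norm h * measure lborel (ball (0::'a) 1)"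
proof -
  let ?I = "ball 0 1 \<inter> ball h 1"
  have eq: "\<bar>indicator (ball 0 1) x - indicator (ball h 1) x :: real\<bar> 
     = indicator (ball 0 1) x + indicator (ball h 1) x - 2 * indicator ?I x" for x
    by (auto simp: indicator_def)
  have fin: "ball c r \<in> fmeasurable lborel" for c :: 'a and r
    using emeasure_lborel_ball_finite[of c r] by (simp add: fmeasurable_def less_top)
  have finI: "?I \<in> fmeasurable lborel" by (intro fmeasurable.Int fin)
  have int: "integrable lborel (indicator S :: 'a \<Rightarrow> real)" if "S \<in> fmeasurable lborel" for S
    using that by (auto simp: fmeasurable_def less_top)
  have [simp]: "integrable lborel (indicator (ball c r) :: 'a \<Rightarrow> real)" for c r by (intro int fin)
  have [simp]: "integrable lborel (indicator ?I :: 'a \<Rightarrow> real)" by (intro int finI)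
  let ?c = "measure lborel (ball (0::'a) 1)"
  have "ball h (1 - norm h) \<subseteq> ?I"
  proof
    fix x assume "x \<in> ball h (1 - norm h)"
    then have *: "dist h x < 1 - norm h" by simp
    moreover have "dist 0 x \<le> dist 0 h + dist h x" by (rule dist_triangle)
    ultimately show "x \<in> ?I" using norm_ge_zero[of h] by (auto simp del: norm_ge_zero)
  qed
  then have "measure lborel (ball h (1 - norm h)) \<le> measure lborel ?I"
    by (intro measure_mono_fmeasurable) (use finI in auto)
  moreover have "measure lborel (ball h (1 - norm h)) = ?c * (1 - norm h) ^ DIM('a)"
    using assms by (subst content_ball) (auto simp: content_ball)
  moreover have "(1 - norm h) ^ DIM('a) \<ge> 1 - real DIM('a) * norm h"
    using Bernoulli_inequality[of "- norm h" "DIM('a)"] assms by simp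
  ultimately have I: "measure lborel ?I \<ge> ?c * (1 - real DIM('a) * norm h)"
    by (smt (verit) measure_nonneg mult_left_mono)
  have "(LINT x|lborel. \<bar>indicator (ball 0 1) x - indicator (ball h 1) x\<bar>) =
     measure lborel (ball 0 (1::real) :: 'a set) + measure lborel (ball h 1) - 2 * measure lborel ?I"
    unfolding eq by simp
  also have "measure lborel (ball h 1) = ?c" by (simp add: content_ball)
  finally show "(LINT x|lborel. \<bar>indicator (ball 0 1) x - indicator (ball h 1) x\<bar>)
           \<le> 2 * real DIM('a) * norm h * ?c"
    using I by (simp add: algebra_simps)
qed

text \<open>
  With \<open>h\<close> half a period in the direction of \<open>z\<close>, the integral over the ball around \<open>h\<close> is the negative
  of the integral over the ball around 0. So twice the integral lives on the symmetric difference
  of the two balls, whose volume is of the order of \<open>norm h\<close>. The assumption on \<open>z\<close> says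
  that \<open>norm h \<le> 1\<close>.
\<close>

lemma norm_integral_wave_ball:
  fixes z :: "'a::euclidean_space"
  assumes z: "norm z \<ge> 1/2"
  shows "norm (LINT x|lborel. indicator (ball 0 1) x *\<^sub>R wave z x)
           \<le> real DIM('a) / (2 * norm z) * measure lborel (ball (0::'a) 1)"
proof -
  define h where "h = (1 / (2 * (norm z)\<^sup>2)) *\<^sub>R z"
  have nh: "norm h = 1 / (2 * norm z)" using z by (auto simp: h_def power2_eq_square)
  then have nh1: "norm h \<le> 1" using z by (simp only: divide_le_eq) auto
  let ?f = "\<lambda>x. indicator (ball 0 1) x *\<^sub>R wave z x"
  let ?g = "\<lambda>x. indicator (ball h 1) x *\<^sub>R wave z x"
  have int: "integrable lborel (\<lambda>x. indicator (ball c 1) x *\<^sub>R wave z x)" for c :: 'a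
  proof (rule Bochner_Integration.integrable_bound)
    show "integrable lborel (indicator (ball c 1) :: 'a \<Rightarrow> real)"
      using emeasure_lborel_ball_finite[of c 1] by (intro integrable_real_indicator) (auto simp: less_top)
    show "(\<lambda>x. indicator (ball c 1) x *\<^sub>R wave z x) \<in> borel_measurable lborel"
      using borel_measurable_wave[of "\<lambda>x. x" lborel z]
      by (intro borel_measurable_scaleR borel_measurable_indicator) auto
  qed auto
  have "(LINT x|lborel. ?g x) = (LINT x|lborel. ?g (h + x))"
    by (subst (1) lborel_distr_plus[of h, symmetric], subst integral_distr) (use int in \<open>auto dest: borel_measurable_integrable\<close>)
  also have "\<dots> = (LINT x|lborel. - ?f x)"
  proof (intro Bochner_Integration.integral_cong refl)
    fix x
    have "wave z h = -1" unfolding h_def by (rule wave_half_period) (use z in auto)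
    then show "?g (h + x) = - ?f x"
      by (auto simp: wave_add indicator_def dist_norm)
  qed
  finally have "2 * (LINT x|lborel. ?f x) = (LINT x|lborel. ?f x) - (LINT x|lborel. ?g x)"
    by simp
  also have "\<dots> = (LINT x|lborel. (indicator (ball 0 1) x - indicator (ball h 1) x) *\<^sub>R wave z x)"
    by (simp add: Bochner_Integration.integral_diff[OF int int, symmetric] scaleR_diff_left)
  also have "norm \<dots> \<le> (LINT x|lborel. norm ((indicator (ball 0 1) x - indicator (ball h 1) x) *\<^sub>R wave z x))"
    by (rule integral_norm_bound)
  also have "\<dots> \<le> 2 * real DIM('a) * norm h * measure lborel (ball (0::'a) 1)"
    using content_symmetric_difference_ball[OF nh1] by simp
  also have "\<dots> = 2 * (real DIM('a) / (2 * norm z) * measure lborel (ball (0::'a) 1))"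
    by (simp add: nh)
  finally have "2 * norm (LINT x|lborel. ?f x)
      \<le> 2 * (real DIM('a) / (2 * norm z) * measure lborel (ball (0::'a) 1))"
    by (simp only: norm_mult norm_numeral)
  then show ?thesis by (simp only: mult_le_cancel_left_pos zero_less_numeral)
qed

text \<open>
  The uniform distribution on the unit ball; for frequencies below \<open>1/2\<close> the bound exceeds 1.
\<close>

lemma exists_ball_random_vector:
  "\<exists>(M :: 'v::euclidean_space measure) Y. prob_space M \<and> Y \<in> borel_measurable M
     \<and> (\<forall>x. norm (Y x :: 'v) \<le> 1)
     \<and> (\<forall>z. z \<noteq> 0 \<longrightarrow> norm (LINT x|M. wave z (Y x)) \<le> DIM('v) / (2 * norm z))"
proof -
  define M where "M = uniform_measure lborel (ball (0::'v) 1)"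
  \<comment> \<open>The uniform measure lives on the whole space, so points off the ball, a null set, are sent to 0
    to have the norm bound everywhere.\<close>
  define Y where "Y x = indicator (ball 0 1) x *\<^sub>R x" for x :: 'v
  let ?c = "measure lborel (ball (0::'v) 1)"
  have c: "?c > 0" by simp
  have em: "emeasure lborel (ball (0::'v) 1) = ennreal ?c" 
    using emeasure_lborel_ball_finite[of "0::'v" 1] by (intro emeasure_eq_ennreal_measure) (simp add: less_top)
  interpret prob_space M
    unfolding M_def by (rule prob_space_uniform_measure) (use c in \<open>simp_all add: em\<close>)
  have M_eq: "M = density lborel (\<lambda>x. ennreal (indicator (ball 0 1) x / ?c))"
    unfolding M_def uniform_measure_def using c
    by (intro arg_cong[where f = "density lborel"] ext)
      (auto simp: em indicator_def divide_ennreal simp flip: ennreal_1)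
  have Y: "Y \<in> borel_measurable borel"
    unfolding Y_def by (intro borel_measurable_scaleR borel_measurable_indicator) auto
  have "norm (LINT x|M. wave z (Y x)) \<le> DIM('v) / (2 * norm z)" if z: "z \<noteq> 0" for z
  proof (cases "norm z \<ge> 1/2")
    case True
    have "(LINT x|M. wave z (Y x)) = (LINT x|lborel. (indicator (ball 0 1) x / ?c) *\<^sub>R wave z (Y x))"
      unfolding M_eq using borel_measurable_wave[OF Y, of z] c
      by (intro integral_density borel_measurable_divide borel_measurable_indicator) auto
    also have "\<dots> = (1 / ?c) *\<^sub>R (LINT x|lborel. indicator (ball 0 1) x *\<^sub>R wave z (Y x))"
      by (subst integral_scaleR_right[symmetric]) simp
    also have "(LINT x|lborel. indicator (ball 0 1) x *\<^sub>R wave z (Y x))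
        = (LINT x|lborel. indicator (ball 0 1) x *\<^sub>R wave z x)"
      by (intro Bochner_Integration.integral_cong) (auto simp: Y_def indicator_def)
    finally have "norm (LINT x|M. wave z (Y x)) = norm (LINT x|lborel. indicator (ball 0 1) x *\<^sub>R wave z x) / ?c"
      using c by (simp add: divide_inverse)
    also have "\<dots> \<le> DIM('v) / (2 * norm z)"
      using norm_integral_wave_ball[OF True] c by (simp only: pos_divide_le_eq)
    finally show ?thesis .
  next
    case False
    have "norm (LINT x|M. wave z (Y x)) \<le> 1" by (rule norm_expectation_wave_le_1)
    also have "1 \<le> DIM('v) / (2 * norm z)"
    proof -
      have "2 * norm z \<le> 1" using False by simp
      also have "1 \<le> real DIM('v)" using DIM_positive[where 'a='v] by linarith
      finally show ?thesis using z by simp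
    qed
    finally show ?thesis .
  qed
  moreover have "norm (Y x) \<le> 1" for x by (auto simp: Y_def indicator_def)
  moreover have "Y \<in> borel_measurable M" using Y by (simp add: M_def)
  ultimately show ?thesis using prob_space_axioms by blast
qed

text \<open>
  Taking the average of \<open>m\<close> independent copies of the uniform distribution on the ball turns decay of
  order 1 into decay of order \<open>m\<close>.
\<close>

lemma exists_smooth_random_vector:
  assumes m: "m \<ge> (1::nat)"
  shows "\<exists>(M :: (nat \<Rightarrow> 'v::euclidean_space) measure) Y. prob_space M \<and> Y \<in> borel_measurable M
     \<and> (\<forall>x. norm (Y x :: 'v) \<le> 1)
     \<and> (\<forall>z. z \<noteq> 0 \<longrightarrow> norm (LINT x|M. wave z (Y x)) \<le> (m * DIM('v) / (2 * norm z)) ^ m)"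
proof -
  obtain M0 :: "'v measure" and Y0 :: "'v \<Rightarrow> 'v" where M0: "prob_space M0" and Y0: "Y0 \<in> borel_measurable M0"
    and Y0_le: "\<And>x. norm (Y0 x) \<le> 1"
    and decay: "\<And>z. z \<noteq> 0 \<Longrightarrow> norm (LINT x|M0. wave z (Y0 x)) \<le> DIM('v) / (2 * norm z)"
    using exists_ball_random_vector[where 'v = 'v] by (elim exE conjE) (rule that, auto)
  interpret M0: prob_space M0 by (rule M0)
  interpret P: product_prob_space "\<lambda>_::nat. M0" "{..<m}" by unfold_locales
  define Y where "Y \<omega> = (\<Sum>i<m. (1 / m) *\<^sub>R Y0 (\<omega> i))" for \<omega>
  have "norm (Y \<omega>) \<le> 1" for \<omega>
  proof -
    have "norm (Y \<omega>) \<le> (\<Sum>i<m. 1 / m)"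
      unfolding Y_def using m Y0_le by (intro sum_norm_le) (auto simp: divide_right_mono)
    then show ?thesis using m by simp
  qed
  moreover have "Y \<in> borel_measurable (PiM {..<m} (\<lambda>_. M0))"
    unfolding Y_def using Y0 by measurable
  moreover have "norm (LINT \<omega>|PiM {..<m} (\<lambda>_. M0). wave z (Y \<omega>)) \<le> (m * DIM('v) / (2 * norm z)) ^ m"
    if z: "z \<noteq> 0" for z
  proof -
    have "(LINT \<omega>|PiM {..<m} (\<lambda>_. M0). wave z (Y \<omega>)) = (\<Prod>i<m. LINT x|M0. wave z ((1 / m) *\<^sub>R Y0 x))"
      unfolding Y_def by (rule P.expectation_wave_sum) (use Y0 in auto)
    then have "norm (LINT \<omega>|PiM {..<m} (\<lambda>_. M0). wave z (Y \<omega>))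
       = norm (LINT x|M0. wave ((1 / m) *\<^sub>R z) (Y0 x)) ^ m"
      by (simp add: wave_scaleR norm_power)
    also have "\<dots> \<le> (DIM('v) / (2 * norm ((1 / real m) *\<^sub>R z))) ^ m"
      using z m by (intro power_mono decay) auto
    also have "DIM('v) / (2 * norm ((1 / real m) *\<^sub>R z)) = m * DIM('v) / (2 * norm z)"
      using m z by (simp add: field_simps)
    finally show ?thesis .
  qed
  ultimately show ?thesis using P.prob_space_axioms by blast
qed

section \<open>Finite samples with small exponential sums\<close>

lemma (in prob_space) exists_le_expectation:
  fixes f :: "'a \<Rightarrow> real"
  assumes "integrable M f"
  shows "\<exists>x\<in>space M. f x \<le> expectation f"
proof (rule ccontr)
  assume "\<not> ?thesis"
  then have "AE x in M. expectation f < f x" by (auto simp: not_le)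
  from expectation_greater[OF assms this] show False by simp
qed

text \<open>
  Hoeffding's lemma for a centred variable with values in \<open>[-1, 1]\<close>.
\<close>

lemma (in prob_space) expectation_exp_le:
  fixes g :: "'a \<Rightarrow> real"
  assumes g[measurable]: "g \<in> borel_measurable M"
    and bound: "\<And>x. x \<in> space M \<Longrightarrow> \<bar>g x\<bar> \<le> 1" and mean: "expectation g = 0" and l: "l > 0"
  shows "integrable M (\<lambda>x. exp (l * g x))" "expectation (\<lambda>x. exp (l * g x)) \<le> exp (l\<^sup>2 / 2)"
proof -
  interpret interval_bounded_random_variable M g "- 1" 1
    by unfold_locales (use bound in \<open>auto intro!: AE_I2 simp: abs_le_iff minus_le_iff\<close>)
  show *: "integrable M (\<lambda>x. exp (l * g x))"
  proof (rule integrable_const_bound[where B = "exp l"])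
    show "AE x in M. norm (exp (l * g x)) \<le> exp l"
      using bound l by (auto intro!: AE_I2 simp: abs_le_iff)
  qed auto
  have "ennreal (expectation (\<lambda>x. exp (l * g x))) = (\<integral>\<^sup>+ x. exp (l * g x) \<partial>M)"
    by (rule nn_integral_eq_integral[symmetric]) (use * in auto)
  also have "\<dots> \<le> ennreal (exp (l\<^sup>2 * (1 - (- 1))\<^sup>2 / 8))"
    by (rule Hoeffdings_lemma_nn_integral_0) (use l mean in auto)
  finally show "expectation (\<lambda>x. exp (l * g x)) \<le> exp (l\<^sup>2 / 2)"
    by simp
qed

text \<open>
  A derandomised Chernoff bound. The points are chosen one after the other, and the sum on the left
  serves as a potential: by Hoeffding's lemma its expectation over the next point grows at most by
  the factor \<open>exp (l\<^sup>2 / 2)\<close>, so some choice of the next point does at least as well.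
\<close>

lemma (in prob_space) exists_sample_exp_sums_le:
  fixes g :: "'i \<Rightarrow> 'a \<Rightarrow> real"
  assumes A: "finite A" and g: "\<And>a. a \<in> A \<Longrightarrow> g a \<in> borel_measurable M"
    and bound: "\<And>a x. a \<in> A \<Longrightarrow> x \<in> space M \<Longrightarrow> \<bar>g a x\<bar> \<le> 1"
    and mean: "\<And>a. a \<in> A \<Longrightarrow> expectation (g a) = 0" and l: "l > 0"
  shows "\<exists>x. (\<forall>j<n. x j \<in> space M)
           \<and> (\<Sum>a\<in>A. exp (l * (\<Sum>j<n. g a (x j)))) \<le> card A * exp (real n * l\<^sup>2 / 2)"
proof (induction n)
  case 0
  then show ?case by simp
next
  case (Suc n)
  then obtain x where x: "\<forall>j<n. x j \<in> space M"
    and le: "(\<Sum>a\<in>A. exp (l * (\<Sum>j<n. g a (x j)))) \<le> card A * exp (real n * l\<^sup>2 / 2)" by blast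
  define w where "w a = exp (l * (\<Sum>j<n. g a (x j)))" for a
  have int: "integrable M (\<lambda>y. exp (l * g a y))"
    and exp_le: "expectation (\<lambda>y. exp (l * g a y)) \<le> exp (l\<^sup>2 / 2)" if "a \<in> A" for a
    using expectation_exp_le[of "g a"] that g bound mean l by auto
  obtain y where y: "y \<in> space M"
    and "(\<Sum>a\<in>A. w a * exp (l * g a y)) \<le> expectation (\<lambda>y. \<Sum>a\<in>A. w a * exp (l * g a y))"
    using exists_le_expectation[of "\<lambda>y. \<Sum>a\<in>A. w a * exp (l * g a y)"] int by auto
  note this(2)
  also have "expectation (\<lambda>y. \<Sum>a\<in>A. w a * exp (l * g a y))
      = (\<Sum>a\<in>A. w a * expectation (\<lambda>y. exp (l * g a y)))"
    using int by (simp add: Bochner_Integration.integral_sum)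
  also have "\<dots> \<le> (\<Sum>a\<in>A. w a * exp (l\<^sup>2 / 2))"
    by (intro sum_mono mult_left_mono exp_le) (auto simp: w_def)
  also have "\<dots> = (\<Sum>a\<in>A. w a) * exp (l\<^sup>2 / 2)"
    by (simp add: sum_distrib_right)
  also have "\<dots> \<le> (card A * exp (n * l\<^sup>2 / 2)) * exp (l\<^sup>2 / 2)"
    using le by (intro mult_right_mono) (auto simp: w_def)
  also have "\<dots> = card A * exp (Suc n * l\<^sup>2 / 2)"
    by (simp add: exp_add[symmetric] field_simps)
  finally have *: "(\<Sum>a\<in>A. w a * exp (l * g a y)) \<le> card A * exp (Suc n * l\<^sup>2 / 2)" .
  show ?case
  proof (intro exI conjI)
    show "\<forall>j<Suc n. (x(n := y)) j \<in> space M"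
      using x y by (auto simp: less_Suc_eq)
    have "exp (l * (\<Sum>j<Suc n. g a ((x(n := y)) j))) = w a * exp (l * g a y)" for a
      by (simp add: w_def exp_add[symmetric] algebra_simps)
    then show "(\<Sum>a\<in>A. exp (l * (\<Sum>j<Suc n. g a ((x(n := y)) j)))) \<le> card A * exp (Suc n * l\<^sup>2 / 2)"
      using * by (simp only:)
  qed
qed

text \<open>
  One sample serves all functions in \<open>A\<close>, and their number enters only through its logarithm. Each
  single exponential is at most the potential of \<open>exists_sample_exp_sums_le\<close>; the parameter
  \<open>l\<close> is the one that minimises the resulting bound \<open>ln (card A) / l + n * l / 2\<close>.
\<close>

lemma (in prob_space) exists_sample_sums_le:
  fixes g :: "'i \<Rightarrow> 'a \<Rightarrow> real"
  assumes A: "finite A" "card A \<ge> 2" and g: "\<And>a. a \<in> A \<Longrightarrow> g a \<in> borel_measurable M"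
    and bound: "\<And>a x. a \<in> A \<Longrightarrow> x \<in> space M \<Longrightarrow> \<bar>g a x\<bar> \<le> 1"
    and mean: "\<And>a. a \<in> A \<Longrightarrow> expectation (g a) = 0" and n: "n \<ge> (1::nat)"
  shows "\<exists>x. (\<forall>j<n. x j \<in> space M)
           \<and> (\<forall>a\<in>A. (\<Sum>j<n. g a (x j)) \<le> sqrt (2 * real n * ln (card A)))"
proof -
  define L where "L = ln (card A)"
  have L: "L > 0" using A by (simp add: L_def)
  define l where "l = sqrt (2 * L / n)"
  have l: "l > 0" using L n by (simp add: l_def)
  have l2: "n * l\<^sup>2 = 2 * L" using L n by (simp add: l_def)
  obtain x where x: "\<forall>j<n. x j \<in> space M"
    and le: "(\<Sum>a\<in>A. exp (l * (\<Sum>j<n. g a (x j)))) \<le> card A * exp (real n * l\<^sup>2 / 2)"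
    using exists_sample_exp_sums_le[of A g l n] A g bound mean l by blast
  have "(\<Sum>j<n. g a (x j)) \<le> sqrt (2 * real n * L)" if a: "a \<in> A" for a
  proof -
    have "exp (l * (\<Sum>j<n. g a (x j))) \<le> (\<Sum>a\<in>A. exp (l * (\<Sum>j<n. g a (x j))))"
      using a A by (intro member_le_sum) auto
    also have "\<dots> \<le> exp L * exp (real n * l\<^sup>2 / 2)" using le A by (simp add: L_def)
    also have "\<dots> = exp (n * l\<^sup>2)" by (simp add: l2 flip: exp_add)
    finally have "l * (\<Sum>j<n. g a (x j)) \<le> l * (n * l)"
      by (simp add: power2_eq_square mult_ac)
    then have "(\<Sum>j<n. g a (x j)) \<le> n * l" using l by simp
    also have "n * l = sqrt (2 * real n * L)"
    proof (rule real_sqrt_unique[symmetric])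
      show "(n * l)\<^sup>2 = 2 * real n * L"
        using l2 by (simp add: power2_eq_square mult_ac)
    qed (use l in auto)
    finally show ?thesis .
  qed
  with x show ?thesis unfolding L_def by blast
qed

text \<open>
  The complex deviations are controlled through their real parts in the four directions
  \<open>1, -1, \<i>, -\<i>\<close>, which explains the factor 4 in front of the number of frequencies.
\<close>

lemma (in prob_space) exists_sample_wave:
  fixes Y :: "'a \<Rightarrow> 'v::euclidean_space"
  assumes Y: "Y \<in> borel_measurable M" and F: "finite F" "F \<noteq> {}" and n: "n \<ge> 1"
  shows "\<exists>x. (\<forall>j<n. x j \<in> space M) \<and>
     (\<forall>z\<in>F. norm ((\<Sum>j<n. wave z (Y (x j))) / of_nat n - expectation (\<lambda>x. wave z (Y x)))
               \<le> 4 * sqrt (2 * ln (4 * real (card F)) / n))"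
proof -
  define c where "c z = expectation (\<lambda>x. wave z (Y x))" for z
  define U where "U = {1, -1, \<i>, -\<i>}"
  have U: "card U = 4" "finite U" by (auto simp: U_def complex_eq_iff)
  define g where "g = (\<lambda>(z, u) x. Re (u * (wave z (Y x) - c z)) / 2)"
  have int: "integrable M (\<lambda>x. u * (wave z (Y x) - c z))" for z u
    using Y by simp
  have cardA: "card (F \<times> U) = 4 * card F" using U by (simp add: card_cartesian_product)
  have g1: "\<bar>g a x\<bar> \<le> 1" if "a \<in> F \<times> U" for a x
  proof -
    obtain z u where a: "a = (z, u)" by force
    have "norm u = 1" using that by (auto simp: a U_def)
    moreover have "norm (wave z (Y x) - c z) \<le> norm (wave z (Y x)) + norm (c z)"
      by (rule norm_triangle_ineq4)
    moreover have "norm (c z) \<le> 1" unfolding c_def by (rule norm_expectation_wave_le_1)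
    ultimately have "norm (u * (wave z (Y x) - c z)) \<le> 2" by (simp add: norm_mult)
    then show ?thesis
      using abs_Re_le_cmod[of "u * (wave z (Y x) - c z)"] unfolding a g_def by simp
  qed
  have mean: "expectation (g a) = 0" for a
  proof -
    obtain z u where a: "a = (z, u)" by force
    have "expectation (\<lambda>x. Re (u * (wave z (Y x) - c z))) = Re (expectation (\<lambda>x. u * (wave z (Y x) - c z)))"
      using int by (rule integral_Re)
    also have "expectation (\<lambda>x. u * (wave z (Y x) - c z)) = 0"
      using Y by (simp add: c_def prob_space Bochner_Integration.integral_diff)
    finally show ?thesis unfolding a g_def by simp
  qed
  have meas: "g a \<in> borel_measurable M" for a
  proof -
    obtain z u where a: "a = (z, u)" by force
    have "(\<lambda>x. Re (u * (wave z (Y x) - c z)) / 2) \<in> borel_measurable M"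
      using borel_measurable_integrable[OF int] by measurable
    then show ?thesis unfolding a g_def by simp
  qed
  have finA: "finite (F \<times> U)" and cardA2: "card (F \<times> U) \<ge> 2"
    using F U card_gt_0_iff[of F] unfolding cardA by auto
  have "\<exists>x. (\<forall>j<n. x j \<in> space M)
      \<and> (\<forall>a\<in>F \<times> U. (\<Sum>j<n. g a (x j)) \<le> sqrt (2 * real n * ln (card (F \<times> U))))"
    by (rule exists_sample_sums_le[where g = g]) (use finA cardA2 meas g1 mean n in blast)+
  then obtain x where x: "\<forall>j<n. x j \<in> space M"
    and le: "\<forall>a\<in>F \<times> U. (\<Sum>j<n. g a (x j)) \<le> sqrt (2 * real n * ln (card (F \<times> U)))"
    by blast
  define B where "B = sqrt (2 * real n * ln (4 * real (card F)))"
  have "norm ((\<Sum>j<n. wave z (Y (x j))) / of_nat n - c z) \<le> 4 * sqrt (2 * ln (4 * real (card F)) / n)" if z: "z \<in> F" for z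
  proof -
    define D where "D = (\<Sum>j<n. wave z (Y (x j)) - c z)"
    have "Re (u * D) / 2 \<le> B" if "u \<in> U" for u
    proof -
      have "(\<Sum>j<n. g (z, u) (x j)) = Re (u * D) / 2"
        by (simp add: g_def D_def sum_distrib_left sum_divide_distrib)
      then show ?thesis using bspec[OF le, of "(z, u)"] z that by (simp add: cardA B_def)
    qed
    from this[of 1] this[of "-1"] this[of \<i>] this[of "-\<i>"]
    have "\<bar>Re D\<bar> \<le> 2 * B" "\<bar>Im D\<bar> \<le> 2 * B" by (auto simp: U_def)
    then have "norm D \<le> 4 * B" using cmod_le[of D] by linarith
    have "D = (\<Sum>j<n. wave z (Y (x j))) - of_nat n * c z"
      by (simp add: D_def sum_subtractf)
    then have "(\<Sum>j<n. wave z (Y (x j))) / of_nat n - c z = D / of_nat n"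
      using n by (simp add: field_simps)
    then have "norm ((\<Sum>j<n. wave z (Y (x j))) / of_nat n - c z) = norm D / n"
      by (simp add: norm_divide)
    also have "\<dots> \<le> 4 * B / n" using \<open>norm D \<le> 4 * B\<close> by (simp add: divide_right_mono)
    also have "B / n = sqrt (2 * ln (4 * real (card F)) / n)"
    proof -
      have "B / n = sqrt (2 * real n * ln (4 * real (card F)) / (real n)\<^sup>2)"
        by (simp add: B_def real_sqrt_divide)
      then show ?thesis using n by (simp add: power2_eq_square)
    qed
    then have "4 * B / n = 4 * sqrt (2 * ln (4 * real (card F)) / n)" by simp
    finally show ?thesis .
  qed
  with x show ?thesis unfolding c_def by blast
qed

text \<open>
  The grid of mesh size \<open>\<eta>\<close>: rounding each coordinate down moves a point by at most \<open>\<eta>\<close> in each of the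
  \<open>DIM('v)\<close> directions. Its size is polynomial in \<open>R / \<eta>\<close>, so its logarithm is harmless
  in \<open>exists_sample_wave\<close>.
\<close>

lemma exists_finite_net:
  fixes R \<eta> :: real
  assumes "R \<ge> 0" "\<eta> > 0"
  shows "\<exists>G :: 'v::euclidean_space set. finite G \<and> G \<noteq> {} \<and> card G \<le> (2 * R / \<eta> + 2) ^ DIM('v)
           \<and> (\<forall>z. norm z \<le> R \<longrightarrow> (\<exists>w\<in>G. norm (z - w) \<le> DIM('v) * \<eta>))"
proof -
  define K where "K = \<lfloor>R / \<eta>\<rfloor>"
  have K: "K \<ge> 0" "real_of_int K \<le> R / \<eta>" using assms by (auto simp: K_def)
  define P where "P = (Basis :: 'v set) \<rightarrow>\<^sub>E {- (K + 1)..K}"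
  define emb where "emb k = (\<Sum>b\<in>Basis. (\<eta> * of_int (k b)) *\<^sub>R b)" for k :: "'v \<Rightarrow> int"
  have finP: "finite P" unfolding P_def by (intro finite_PiE) auto
  have "card (emb ` P) \<le> card P" using finP by (rule card_image_le)
  also have "card P = nat (2 * K + 2) ^ DIM('v)"
    by (simp add: P_def card_PiE algebra_simps)
  finally have "real (card (emb ` P)) \<le> real (nat (2 * K + 2)) ^ DIM('v)"
    by (metis of_nat_le_iff of_nat_power)
  also have "\<dots> \<le> (2 * R / \<eta> + 2) ^ DIM('v)"
    using K by (intro power_mono) auto
  finally have card: "real (card (emb ` P)) \<le> (2 * R / \<eta> + 2) ^ DIM('v)" .
  have near: "\<exists>w\<in>emb ` P. norm (z - w) \<le> DIM('v) * \<eta>" if z: "norm z \<le> R" for z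
  proof -
    define k where "k = (\<lambda>b\<in>Basis. \<lfloor>z \<bullet> b / \<eta>\<rfloor>)"
    have "k \<in> P"
      unfolding P_def
    proof
      fix b :: 'v assume b: "b \<in> Basis"
      have "\<bar>z \<bullet> b\<bar> \<le> R" using Basis_le_norm[OF b, of z] z by simp
      then have "\<bar>z \<bullet> b / \<eta>\<bar> \<le> R / \<eta>" using assms by (simp add: divide_right_mono abs_divide)
      then have "z \<bullet> b / \<eta> \<le> R / \<eta>" "- (R / \<eta>) \<le> z \<bullet> b / \<eta>" by linarith+
      then have "\<lfloor>z \<bullet> b / \<eta>\<rfloor> \<le> K" "- (K + 1) \<le> \<lfloor>z \<bullet> b / \<eta>\<rfloor>"
        unfolding K_def by linarith+
      then show "k b \<in> {- (K + 1)..K}" using b by (simp add: k_def)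
    qed (simp add: k_def)
    moreover have "norm (z - emb k) \<le> DIM('v) * \<eta>"
    proof -
      have "norm (z - emb k) \<le> (\<Sum>b\<in>Basis. \<bar>(z - emb k) \<bullet> b\<bar>)" by (rule norm_le_l1)
      also have "\<dots> \<le> (\<Sum>b\<in>(Basis::'v set). \<eta>)"
      proof (rule sum_mono)
        fix b :: 'v assume b: "b \<in> Basis"
        have "(z - emb k) \<bullet> b = \<eta> * frac (z \<bullet> b / \<eta>)"
          using b assms by (simp add: emb_def k_def inner_diff_left frac_def algebra_simps)
        moreover have "\<eta> * frac (z \<bullet> b / \<eta>) \<le> \<eta> * 1"
          using assms frac_lt_1[of "z \<bullet> b / \<eta>"] by (intro mult_left_mono) auto
        ultimately show "\<bar>(z - emb k) \<bullet> b\<bar> \<le> \<eta>" using assms by (simp add: abs_mult)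
      qed
      finally show ?thesis by simp
    qed
    ultimately show ?thesis by blast
  qed
  show ?thesis
  proof (intro exI conjI allI impI)
    show "finite (emb ` P)" using finP by simp
    show "emb ` P \<noteq> {}" using near[of 0] assms by auto
  qed (use card near in auto)
qed

text \<open>
  A sample adapted to a net of mesh size \<open>1 / n\<close> is good for all frequencies in the ball, because
  both the exponential sum and the expectation are Lipschitz in the frequency.
\<close>

lemma (in prob_space) exists_sample_wave_ball:
  fixes Y :: "'a \<Rightarrow> 'v::euclidean_space"
  assumes Y: "Y \<in> borel_measurable M" and Y1: "\<And>x. x \<in> space M \<Longrightarrow> norm (Y x) \<le> 1"
    and R: "R \<ge> 0" and n: "n \<ge> 1"
  shows "\<exists>y. (\<forall>j<n. norm (y j) \<le> 1) \<and>
     (\<forall>z. norm z \<le> R \<longrightarrow>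
        norm ((\<Sum>j<n. wave z (y j)) / of_nat n - expectation (\<lambda>x. wave z (Y x)))
          \<le> 4 * sqrt (2 * ln (4 * (2 * R * n + 2) ^ DIM('v)) / n) + 4 * pi * DIM('v) / n)"
proof -
  obtain G :: "'v set" where G: "finite G" "G \<noteq> {}" and card: "card G \<le> (2 * R / (1 / n) + 2) ^ DIM('v)"
    and near: "\<And>z. norm z \<le> R \<Longrightarrow> \<exists>w\<in>G. norm (z - w) \<le> DIM('v) * (1 / n)"
    using exists_finite_net[of R "1 / n"] R n by auto
  obtain x where x: "\<forall>j<n. x j \<in> space M" and 
    le: "\<forall>z\<in>G. norm ((\<Sum>j<n. wave z (Y (x j))) / of_nat n - expectation (\<lambda>x. wave z (Y x)))
               \<le> 4 * sqrt (2 * ln (4 * real (card G)) / n)"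
    using exists_sample_wave[OF Y G n] by auto
  have cardG: "real (card G) > 0" using G by (simp add: card_gt_0_iff)
  show ?thesis
  proof (intro exI[of _ "\<lambda>j. Y (x j)"] conjI allI impI)
    fix j assume "j < n" then show "norm (Y (x j)) \<le> 1" using x Y1 by blast
  next
    fix z :: 'v assume "norm z \<le> R"
    from near[OF this] obtain w where w: "w \<in> G" "norm (z - w) \<le> DIM('v) / n" by auto
    have lip: "norm (wave z (Y u) - wave w (Y u)) \<le> 2 * pi * (DIM('v) / n)" if "u \<in> space M" for u
    proof -
      have "norm (wave z (Y u) - wave w (Y u)) \<le> 2 * pi * norm (z - w) * norm (Y u)"
        by (rule wave_lipschitz)
      also have "\<dots> \<le> 2 * pi * (DIM('v) / n) * 1"
        using w Y1[OF that] by (intro mult_mono) auto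
      finally show ?thesis by simp
    qed
    have "norm ((\<Sum>j<n. wave z (Y (x j))) / of_nat n - (\<Sum>j<n. wave w (Y (x j))) / of_nat n)
        = norm (\<Sum>j<n. wave z (Y (x j)) - wave w (Y (x j))) / n"
      by (simp add: norm_divide sum_subtractf flip: diff_divide_distrib)
    also have "\<dots> \<le> (\<Sum>j<n. 2 * pi * (DIM('v) / n)) / n"
      using x lip by (intro divide_right_mono sum_norm_le) auto
    also have "\<dots> = 2 * pi * (DIM('v) / n)" using n by simp
    finally have 1: "norm ((\<Sum>j<n. wave z (Y (x j))) / of_nat n - (\<Sum>j<n. wave w (Y (x j))) / of_nat n)
       \<le> 2 * pi * (DIM('v) / n)" .
    have "expectation (\<lambda>x. wave z (Y x)) - expectation (\<lambda>x. wave w (Y x))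
        = expectation (\<lambda>x. wave z (Y x) - wave w (Y x))"
      using Y by simp
    also have "norm \<dots> \<le> expectation (\<lambda>x. norm (wave z (Y x) - wave w (Y x)))"
      by (rule integral_norm_bound)
    also have "\<dots> \<le> expectation (\<lambda>x. 2 * pi * (DIM('v) / n))"
      using Y lip by (intro integral_mono) (auto intro!: integrable_norm)
    finally have 2: "norm (expectation (\<lambda>x. wave z (Y x)) - expectation (\<lambda>x. wave w (Y x)))
       \<le> 2 * pi * (DIM('v) / n)" by (simp add: prob_space)
    have "4 * sqrt (2 * ln (4 * real (card G)) / n) \<le> 4 * sqrt (2 * ln (4 * (2 * R * n + 2) ^ DIM('v)) / n)"
    proof (intro mult_left_mono real_sqrt_le_mono divide_right_mono)
      have "4 * real (card G) \<le> 4 * (2 * R * n + 2) ^ DIM('v)" using card by simp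
      then show "ln (4 * real (card G)) \<le> ln (4 * (2 * R * n + 2) ^ DIM('v))"
        using cardG by (subst ln_le_cancel_iff) linarith+
    qed auto
    moreover have "norm (a - b) \<le> norm (a - a') + norm (a' - b') + norm (b - b')" for a b a' b' :: complex
      using norm_triangle_ineq[of "a - a'" "a' - b"] norm_triangle_ineq[of "a' - b'" "b' - b"]
      by (simp add: norm_minus_commute)
    note this[of "(\<Sum>j<n. wave z (Y (x j))) / of_nat n" "expectation (\<lambda>x. wave z (Y x))"
        "(\<Sum>j<n. wave w (Y (x j))) / of_nat n" "expectation (\<lambda>x. wave w (Y x))"]
    moreover have "norm ((\<Sum>j<n. wave w (Y (x j))) / of_nat n - expectation (\<lambda>x. wave w (Y x)))
               \<le> 4 * sqrt (2 * ln (4 * real (card G)) / n)" using le w(1) by blast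
    moreover have "2 * pi * (DIM('v) / n) + 2 * pi * (DIM('v) / n) = 4 * pi * DIM('v) / n" by simp
    ultimately show "norm ((\<Sum>j<n. wave z (Y (x j))) / of_nat n - expectation (\<lambda>x. wave z (Y x)))
          \<le> 4 * sqrt (2 * ln (4 * (2 * R * n + 2) ^ DIM('v)) / n) + 4 * pi * DIM('v) / n"
      using 1 2 by linarith
  qed
qed

text \<open>
  With \<open>T powr c\<close> points the deviation is \<open>T powr (- c / 2)\<close> up to logarithms, even for all frequencies
  up to an arbitrary power of \<open>T\<close>.
\<close>

lemma (in prob_space) eventually_exists_sample_wave:
  fixes Y :: "'a \<Rightarrow> 'v::euclidean_space"
  assumes Y: "Y \<in> borel_measurable M" and Y1: "\<And>x. x \<in> space M \<Longrightarrow> norm (Y x) \<le> 1"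
    and a: "a > 0" and b: "b > 0" "2 * b < c"
  shows "\<forall>\<^sub>F T in at_top. \<exists>y. (\<forall>j<nat \<lceil>T powr c\<rceil>. norm (y j) \<le> 1) \<and>
     (\<forall>z. norm z \<le> T powr a \<longrightarrow>
        norm ((\<Sum>j<nat \<lceil>T powr c\<rceil>. wave z (y j)) / of_nat (nat \<lceil>T powr c\<rceil>)
              - expectation (\<lambda>x. wave z (Y x))) \<le> T powr (- b))"
proof -
  let ?d = "real DIM('v)"
  have c: "c > 0" using b by simp
  have "\<forall>\<^sub>F T in at_top. 4 * sqrt (2 * (ln 4 + ?d * (ln 6 + (a + c) * ln T)) / T powr c)
       + 4 * pi * ?d / T powr c \<le> T powr (- b)"
    using a b c by real_asymp
  then show ?thesis using eventually_ge_at_top[of 1]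
  proof eventually_elim
    case (elim T)
    define n where "n = nat \<lceil>T powr c\<rceil>"
    have Tc: "T powr c \<ge> 1" using elim c by (simp add: ge_one_powr_ge_zero)
    have n: "n \<ge> 1" "T powr c \<le> n" "n \<le> 2 * T powr c"
      unfolding n_def using Tc by linarith+
    have "2 * (T powr a) * n + 2 \<le> 6 * T powr (a + c)"
    proof -
      have "(T powr a) * n \<le> T powr a * (2 * T powr c)"
        using n by (intro mult_left_mono) auto
      moreover have "T powr (a + c) \<ge> 1" using elim a c by (simp add: ge_one_powr_ge_zero)
      ultimately show ?thesis by (simp add: powr_add)
    qed
    then have "4 * (2 * (T powr a) * n + 2) ^ DIM('v) \<le> 4 * (6 * T powr (a + c)) ^ DIM('v)"
      by (intro mult_left_mono power_mono) auto
    then have "ln (4 * (2 * (T powr a) * n + 2) ^ DIM('v)) \<le> ln (4 * (6 * T powr (a + c)) ^ DIM('v))"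
      by (intro ln_mono mult_pos_pos zero_less_power add_nonneg_pos) auto
    also have "\<dots> = ln 4 + ?d * (ln 6 + (a + c) * ln T)"
      using elim by (simp add: ln_mult ln_realpow ln_powr distrib_left)
    finally have ln_le: "ln (4 * (2 * (T powr a) * n + 2) ^ DIM('v)) \<le> ln 4 + ?d * (ln 6 + (a + c) * ln T)" .
    have "4 * sqrt (2 * ln (4 * (2 * (T powr a) * n + 2) ^ DIM('v)) / n) + 4 * pi * DIM('v) / n
        \<le> 4 * sqrt (2 * (ln 4 + ?d * (ln 6 + (a + c) * ln T)) / T powr c) + 4 * pi * ?d / T powr c"
    proof (intro add_mono mult_left_mono real_sqrt_le_mono frac_le ln_le)
      show "0 \<le> 2 * (ln 4 + ?d * (ln 6 + (a + c) * ln T))"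
        using elim a c by simp
    qed (use Tc n in auto)
    also have "\<dots> \<le> T powr (- b)" using elim by simp
    finally have bound: "4 * sqrt (2 * ln (4 * (2 * (T powr a) * n + 2) ^ DIM('v)) / n) + 4 * pi * DIM('v) / n
      \<le> T powr (- b)" .
    show ?case
      unfolding n_def[symmetric]
    proof -
      have "\<exists>y. (\<forall>j<n. norm (y j) \<le> 1) \<and> (\<forall>z. norm z \<le> T powr a \<longrightarrow>
          norm ((\<Sum>j<n. wave z (y j)) / of_nat n - expectation (\<lambda>x. wave z (Y x)))
          \<le> 4 * sqrt (2 * ln (4 * (2 * (T powr a) * n + 2) ^ DIM('v)) / n) + 4 * pi * DIM('v) / n)"
        by (rule exists_sample_wave_ball) (use Y Y1 n in auto)
      then obtain y where y: "\<forall>j<n. norm (y j) \<le> 1"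
        and le: "\<forall>z. norm z \<le> T powr a \<longrightarrow>
          norm ((\<Sum>j<n. wave z (y j)) / of_nat n - expectation (\<lambda>x. wave z (Y x)))
          \<le> 4 * sqrt (2 * ln (4 * (2 * (T powr a) * n + 2) ^ DIM('v)) / n) + 4 * pi * DIM('v) / n"
        by (elim exE conjE)
      show "\<exists>y. (\<forall>j<n. norm (y j) \<le> 1) \<and> (\<forall>z. norm z \<le> T powr a \<longrightarrow>
          norm ((\<Sum>j<n. wave z (y j)) / of_nat n - expectation (\<lambda>x. wave z (Y x))) \<le> T powr (- b))"
        by (intro exI[of _ y] conjI y allI impI order_trans[OF le[rule_format] bound])
    qed
  qed
qed

text \<open>
  The factors of the random series are rescaled copies of these samples. The first term of the bound
  is inherited from the smooth distribution, the second one is the sampling error. The constant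
  \<open>C\<close> is uniform in \<open>T\<close>.
\<close>

lemma exists_decaying_sample:
  fixes a b c :: real
  assumes m: "m \<ge> (1::nat)" and a: "a > 0" and b: "b > 0" "2 * b < c"
  shows "\<exists>C\<ge>0. \<forall>\<^sub>F T in at_top. \<exists>y :: nat \<Rightarrow> 'v::euclidean_space.
     (\<forall>j<nat \<lceil>T powr c\<rceil>. norm (y j) \<le> 1) \<and>
     (\<forall>z. z \<noteq> 0 \<longrightarrow> norm z \<le> T powr a \<longrightarrow>
        norm ((\<Sum>j<nat \<lceil>T powr c\<rceil>. wave z (y j)) / of_nat (nat \<lceil>T powr c\<rceil>))
          \<le> (C / norm z) ^ m + T powr (- b))"
proof -
  obtain M :: "(nat \<Rightarrow> 'v) measure" and Y :: "(nat \<Rightarrow> 'v) \<Rightarrow> 'v"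
    where M: "prob_space M" and Y: "Y \<in> borel_measurable M" and Y1: "\<And>x. norm (Y x) \<le> 1"
      and decay: "\<And>z. z \<noteq> 0 \<Longrightarrow> norm (LINT x|M. wave z (Y x)) \<le> (m * DIM('v) / (2 * norm z)) ^ m"
    using exists_smooth_random_vector[OF m, where 'v = 'v] by (elim exE conjE) (rule that, auto)
  interpret prob_space M by (rule M)
  define C where "C = m * DIM('v) / 2"
  have "\<forall>\<^sub>F T in at_top. \<exists>y :: nat \<Rightarrow> 'v. (\<forall>j<nat \<lceil>T powr c\<rceil>. norm (y j) \<le> 1) \<and>
     (\<forall>z. z \<noteq> 0 \<longrightarrow> norm z \<le> T powr a \<longrightarrow>
        norm ((\<Sum>j<nat \<lceil>T powr c\<rceil>. wave z (y j)) / of_nat (nat \<lceil>T powr c\<rceil>))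
          \<le> (C / norm z) ^ m + T powr (- b))"
    using eventually_exists_sample_wave[OF Y Y1 a b]
  proof eventually_elim
    case (elim T)
    define n where "n = nat \<lceil>T powr c\<rceil>"
    from elim obtain y where y: "\<forall>j<n. norm (y j) \<le> 1"
      and le: "\<forall>z. norm z \<le> T powr a \<longrightarrow>
        norm ((\<Sum>j<n. wave z (y j)) / of_nat n - expectation (\<lambda>x. wave z (Y x))) \<le> T powr (- b)"
      unfolding n_def by (elim exE conjE)
    have "norm ((\<Sum>j<n. wave z (y j)) / of_nat n) \<le> (C / norm z) ^ m + T powr (- b)"
      if z: "z \<noteq> 0" "norm z \<le> T powr a" for z
    proof -
      have "norm (expectation (\<lambda>x. wave z (Y x))) \<le> (C / norm z) ^ m"
        using decay[OF z(1)] by (simp add: C_def)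
      moreover have "norm ((\<Sum>j<n. wave z (y j)) / of_nat n - expectation (\<lambda>x. wave z (Y x))) \<le> T powr (- b)"
        using le z by blast
      ultimately show ?thesis
        using norm_triangle_sub[of "(\<Sum>j<n. wave z (y j)) / of_nat n" "expectation (\<lambda>x. wave z (Y x))"]
        by linarith
    qed
    with y show ?case unfolding n_def[symmetric] by (intro exI[of _ y] conjI) auto
  qed
  moreover have "C \<ge> 0" by (simp add: C_def)
  ultimately show ?thesis by (intro exI[of _ C] conjI)
qed

section \<open>Random series over finite digit sets\<close>

text \<open>
  The \<open>k\<close>-th term of the series is one of the \<open>N k\<close> points \<open>x k 0, x k 1, \<dots>\<close>, chosen uniformly and
  independently of the other terms. Repetitions among the points are allowed.
\<close>

locale random_series =
  fixes N :: "nat \<Rightarrow> nat" and x :: "nat \<Rightarrow> nat \<Rightarrow> 'v::euclidean_space" and r :: "nat \<Rightarrow> real"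
  assumes N_pos: "0 < N k"
    and norm_x_le: "j < N k \<Longrightarrow> norm (x k j) \<le> r k"
    and summable_r: "summable r"
begin

definition digit_space :: "(nat \<Rightarrow> nat) measure" where
  "digit_space = PiM UNIV (\<lambda>k. uniform_count_measure {..<N k})"

definition series :: "(nat \<Rightarrow> nat) \<Rightarrow> 'v" where
  "series \<omega> = (\<Sum>k. x k (\<omega> k))"

definition law :: "'v measure" where
  "law = distr digit_space borel series"

definition partial_sums :: "nat \<Rightarrow> 'v set" where
  "partial_sums k = (\<lambda>\<omega>. \<Sum>i<k. x i (\<omega> i)) ` (\<Pi>\<^sub>E i\<in>{..<k}. {..<N i})"

definition tail :: "nat \<Rightarrow> real" where
  "tail k = (\<Sum>i. r (i + k))"

definition cantor_set :: "'v set" where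
  "cantor_set = (\<Inter>k. \<Union>c\<in>partial_sums k. cball c (tail k))"

sublocale digits: product_prob_space "\<lambda>k. uniform_count_measure {..<N k}" UNIV
proof -
  interpret D: prob_space "uniform_count_measure {..<N k}" for k
    using N_pos[of k] by (intro prob_space_uniform_count_measure) auto
  show "product_prob_space (\<lambda>k. uniform_count_measure {..<N k})" by unfold_locales
qed

lemma prob_space_digit_space: "prob_space digit_space"
  unfolding digit_space_def by (rule digits.prob_space_axioms)

lemma digit_less: "\<omega> \<in> space digit_space \<Longrightarrow> \<omega> k < N k"
  by (auto simp: digit_space_def space_PiM space_uniform_count_measure PiE_def Pi_def)

lemma summable_digits: "\<omega> \<in> space digit_space \<Longrightarrow> summable (\<lambda>k. x k (\<omega> k))"
  by (rule summable_comparison_test'[OF summable_r]) (use norm_x_le digit_less in auto)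

lemma measurable_partial_sum [measurable]:
  "(\<lambda>\<omega>. \<Sum>i<n. x i (\<omega> i)) \<in> borel_measurable digit_space"
proof -
  have "(\<lambda>\<omega>. x i (\<omega> i)) \<in> borel_measurable digit_space" for i
  proof (rule measurable_compose[of "\<lambda>\<omega>. \<omega> i" _ "uniform_count_measure {..<N i}" "x i"])
    show "(\<lambda>\<omega>. \<omega> i) \<in> digit_space \<rightarrow>\<^sub>M uniform_count_measure {..<N i}"
      unfolding digit_space_def by (rule measurable_component_singleton) simp
    show "x i \<in> borel_measurable (uniform_count_measure {..<N i})"
      by (auto simp: measurable_def sets_uniform_count_measure space_uniform_count_measure)
  qed
  then show ?thesis by measurable
qed

lemma partial_sum_tendsto:
  "\<omega> \<in> space digit_space \<Longrightarrow> (\<lambda>n. \<Sum>i<n. x i (\<omega> i)) \<longlonglongrightarrow> series \<omega>"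
  unfolding series_def by (rule summable_LIMSEQ[OF summable_digits])

lemma measurable_series [measurable]: "series \<in> borel_measurable digit_space"
  by (rule borel_measurable_LIMSEQ_metric[OF measurable_partial_sum partial_sum_tendsto])

lemma prob_space_law: "prob_space law"
  unfolding law_def by (rule prob_space.prob_space_distr[OF prob_space_digit_space]) simp

lemma sets_law [simp]: "sets law = sets borel"
  by (simp add: law_def)

text \<open>
  The transform of the law is the infinite product of the transforms of the terms. All factors have
  norm at most 1, so each of them bounds the product.
\<close>

lemma norm_fourier_transform_law_le:
  "norm (fourier_transform law z) \<le> norm ((\<Sum>j<N k. wave z (x k j)) / of_nat (N k))"
proof -
  interpret prob_space digit_space by (rule prob_space_digit_space)
  define avg where "avg i = (\<Sum>j<N i. wave z (x i j)) / of_nat (N i)" for i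
  have avg: "(LINT j|uniform_count_measure {..<N i}. wave z (x i j)) = avg i" for i
    unfolding uniform_count_measure_def avg_def
    by (subst lebesgue_integral_point_measure_finite)
      (auto simp: scaleR_conv_of_real divide_inverse sum_distrib_left mult.commute)
  have avg_le: "norm (avg i) \<le> 1" for i
  proof -
    have "norm (\<Sum>j<N i. wave z (x i j)) \<le> (\<Sum>j<N i. 1)"
      by (rule sum_norm_le) simp
    then show ?thesis using N_pos[of i] by (simp add: avg_def norm_divide)
  qed
  have expect: "(LINT \<omega>|digit_space. wave z (\<Sum>i<n. x i (\<omega> i))) = (\<Prod>i<n. avg i)" for n
    unfolding avg[symmetric] digit_space_def
    by (rule digits.expectation_wave_sum) (auto simp: measurable_def sets_uniform_count_measure space_uniform_count_measure)
  have "(\<lambda>n. LINT \<omega>|digit_space. wave z (\<Sum>i<n. x i (\<omega> i))) \<longlonglongrightarrow> (LINT \<omega>|digit_space. wave z (series \<omega>))"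
  proof (rule integral_dominated_convergence[where w = "\<lambda>_. 1"])
    show "AE \<omega> in digit_space. (\<lambda>n. wave z (\<Sum>i<n. x i (\<omega> i))) \<longlonglongrightarrow> wave z (series \<omega>)"
    proof (rule AE_I2)
      fix \<omega> assume "\<omega> \<in> space digit_space"
      then show "(\<lambda>n. wave z (\<Sum>i<n. x i (\<omega> i))) \<longlonglongrightarrow> wave z (series \<omega>)"
        unfolding wave_def by (intro tendsto_intros partial_sum_tendsto)
    qed
  qed (auto intro!: borel_measurable_wave)
  also have "(LINT \<omega>|digit_space. wave z (series \<omega>)) = fourier_transform law z"
    unfolding fourier_transform_eq_wave law_def
    by (rule integral_distr[symmetric]) (auto intro: borel_measurable_wave)
  finally have lim: "(\<lambda>n. \<Prod>i<n. avg i) \<longlonglongrightarrow> fourier_transform law z" by (simp add: expect)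
  have "norm (fourier_transform law z) \<le> norm (avg k)"
  proof (rule LIMSEQ_le_const2[OF tendsto_norm[OF lim]], intro exI allI impI)
    fix n assume "Suc k \<le> n"
    then have "norm (\<Prod>i<n. avg i) = norm (avg k) * (\<Prod>i\<in>{..<n} - {k}. norm (avg i))"
      by (subst prod.remove[of _ k]) (auto simp: norm_mult prod_norm)
    also have "\<dots> \<le> norm (avg k) * 1"
      by (intro mult_left_mono prod_le_1) (auto simp: avg_le)
    finally show "norm (\<Prod>i<n. avg i) \<le> norm (avg k)" by simp
  qed
  then show ?thesis by (simp add: avg_def)
qed

lemma finite_partial_sums: "finite (partial_sums k)"
  unfolding partial_sums_def by (intro finite_imageI finite_PiE) auto

lemma card_partial_sums_le: "card (partial_sums k) \<le> (\<Prod>i<k. N i)"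
proof -
  have "card (partial_sums k) \<le> card (\<Pi>\<^sub>E i\<in>{..<k}. {..<N i})"
    unfolding partial_sums_def by (intro card_image_le finite_PiE) auto
  then show ?thesis by (simp add: card_PiE)
qed

lemma closed_cantor_set: "closed cantor_set"
  unfolding cantor_set_def by (intro closed_INT ballI closed_UN finite_partial_sums closed_cball)

lemma series_in_cantor_set:
  assumes \<omega>: "\<omega> \<in> space digit_space"
  shows "series \<omega> \<in> cantor_set"
  unfolding cantor_set_def
proof
  fix k
  let ?c = "\<Sum>i<k. x i (\<omega> i)"
  have "?c = (\<Sum>i<k. x i (restrict \<omega> {..<k} i))" by (intro sum.cong) auto
  moreover have "restrict \<omega> {..<k} \<in> (\<Pi>\<^sub>E i\<in>{..<k}. {..<N i})"
    using digit_less[OF \<omega>] by auto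
  ultimately have c: "?c \<in> partial_sums k" unfolding partial_sums_def by blast
  have summable_shift: "summable (\<lambda>i. r (i + k))"
    using summable_r by (simp add: summable_iff_shift)
  have "series \<omega> - ?c = (\<Sum>i. x (i + k) (\<omega> (i + k)))"
    unfolding series_def using suminf_minus_initial_segment[OF summable_digits[OF \<omega>], of k] by simp
  also have "norm \<dots> \<le> (\<Sum>i. norm (x (i + k) (\<omega> (i + k))))"
    by (rule summable_norm, rule summable_comparison_test'[OF summable_shift])
      (use norm_x_le digit_less[OF \<omega>] in auto)
  also have "\<dots> \<le> tail k"
    unfolding tail_def
    by (intro suminf_le summable_shift summable_comparison_test'[OF summable_shift])
      (use norm_x_le digit_less[OF \<omega>] in auto)
  finally have "series \<omega> \<in> cball ?c (tail k)" by (simp add: dist_norm norm_minus_commute)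
  with c show "series \<omega> \<in> (\<Union>c\<in>partial_sums k. cball c (tail k))" by blast
qed

text \<open>
  A topological support is contained in a closed set as soon as the complement is a null set; here
  no value of the series lies in the complement.
\<close>

lemma law_in_measures_on: "law \<in> measures_on cantor_set"
proof -
  interpret prob_space law by (rule prob_space_law)
  have "emeasure law (- cantor_set) = emeasure digit_space (series -` (- cantor_set) \<inter> space digit_space)"
    unfolding law_def using closed_cantor_set by (intro emeasure_distr) auto
  also have "series -` (- cantor_set) \<inter> space digit_space = {}"
    using series_in_cantor_set by blast
  finally have null: "emeasure law (- cantor_set) = 0" by simp
  have "measure_support law \<subseteq> cantor_set"
  proof
    fix y assume "y \<in> measure_support law"
    show "y \<in> cantor_set"
    proof (rule ccontr)
      assume "y \<notin> cantor_set"
      then have "emeasure law (- cantor_set) > 0"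
        using \<open>y \<in> measure_support law\<close> closed_cantor_set unfolding measure_support_def by blast
      with null show False by simp
    qed
  qed
  moreover have "space law = UNIV" by (simp add: law_def)
  ultimately show ?thesis
    using emeasure_space_1 finite_measure_axioms unfolding measures_on_def by auto
qed

text \<open>
  Points within \<open>tail k\<close> of \<open>a\<close> and \<open>b\<close> have a distance within \<open>2 * tail k\<close> of \<open>dist a b\<close>.
\<close>

lemma distance_set_cantor_set_cover:
  "\<exists>F. finite F \<and> card F \<le> (\<Prod>i<k. N i)\<^sup>2 \<and> distance_set cantor_set \<subseteq> (\<Union>c\<in>F. cball c (2 * tail k))"
proof (intro exI conjI)
  let ?F = "(\<lambda>(a, b). dist a b) ` (partial_sums k \<times> partial_sums k)"
  show "finite ?F" by (intro finite_imageI finite_cartesian_product finite_partial_sums)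
  have "card ?F \<le> card (partial_sums k \<times> partial_sums k)"
    by (intro card_image_le finite_cartesian_product finite_partial_sums)
  also have "\<dots> = card (partial_sums k) ^ 2"
    by (simp add: card_cartesian_product power2_eq_square)
  also have "\<dots> \<le> (\<Prod>i<k. N i)\<^sup>2"
    by (intro power_mono card_partial_sums_le) auto
  finally show "card ?F \<le> (\<Prod>i<k. N i)\<^sup>2" .
  show "distance_set cantor_set \<subseteq> (\<Union>c\<in>?F. cball c (2 * tail k))"
  proof
    fix t assume "t \<in> distance_set cantor_set"
    then obtain y z where t: "t = dist y z" and yz: "y \<in> cantor_set" "z \<in> cantor_set"
      unfolding distance_set_def by blast
    obtain a where a: "a \<in> partial_sums k" "dist a y \<le> tail k"
      using yz(1) unfolding cantor_set_def by auto
    obtain b where b: "b \<in> partial_sums k" "dist b z \<le> tail k"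
      using yz(2) unfolding cantor_set_def by auto
    have "\<bar>dist a b - t\<bar> \<le> dist a y + dist b z"
      unfolding t using dist_triangle[of a b y] dist_triangle[of y b z] dist_triangle[of y z a] dist_triangle[of a z b]
      by (simp add: dist_commute)
    then have "t \<in> cball (dist a b) (2 * tail k)"
      using a b by (simp add: dist_real_def)
    then show "t \<in> (\<Union>c\<in>?F. cball c (2 * tail k))" using a(1) b(1) by force
  qed
qed

end

section \<open>The Fourier spectrum dominates the Fourier dimension\<close>

text \<open>
  Dyadic shells reduce the integrability of powers of the norm to geometric series.
\<close>

definition shell :: "real \<Rightarrow> 'a::euclidean_space set" where
  "shell \<rho> = {z. \<rho> < norm z \<and> norm z \<le> 2 * \<rho>}"

lemma sets_shell [measurable]: "shell \<rho> \<in> sets borel"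
  unfolding shell_def by measurable

text \<open>
  On the shell the integrand is comparable to \<open>\<rho> powr (c - d)\<close>, and the volume to \<open>\<rho> powr d\<close>. The
  factor \<open>2 powr \<bar>c - d\<bar>\<close> covers both signs of the exponent.
\<close>

lemma nn_integral_shell_le:
  fixes c \<rho> :: real
  defines "d \<equiv> real DIM('a::euclidean_space)"
  assumes \<rho>: "\<rho> > 0"
  shows "(\<integral>\<^sup>+z. ennreal (norm (z::'a) powr (c - d)) * indicator (shell \<rho>) z \<partial>lborel)
           \<le> ennreal (2 powr \<bar>c - d\<bar> * unit_ball_vol d * 2 powr d * \<rho> powr c)"
proof -
  have le: "norm z powr (c - d) \<le> 2 powr \<bar>c - d\<bar> * \<rho> powr (c - d)" if "z \<in> shell \<rho>" for z :: 'a
  proof (cases "c - d \<ge> 0")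
    case True
    have "norm z powr (c - d) \<le> (2 * \<rho>) powr (c - d)"
      using that True by (intro powr_mono2) (auto simp: shell_def)
    then show ?thesis using True \<rho> by (simp add: powr_mult)
  next
    case False
    have "norm z powr (c - d) \<le> \<rho> powr (c - d)"
      using that False \<rho> by (intro powr_mono2') (auto simp: shell_def)
    also have "\<dots> \<le> 2 powr \<bar>c - d\<bar> * \<rho> powr (c - d)"
      by (simp add: mult_le_cancel_right1 ge_one_powr_ge_zero)
    finally show ?thesis .
  qed
  have "(\<integral>\<^sup>+z. ennreal (norm (z::'a) powr (c - d)) * indicator (shell \<rho>) z \<partial>lborel)
      \<le> (\<integral>\<^sup>+z. ennreal (2 powr \<bar>c - d\<bar> * \<rho> powr (c - d)) * indicator (cball 0 (2 * \<rho>) :: 'a set) z \<partial>lborel)"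
    using le by (intro nn_integral_mono) (auto simp: indicator_def shell_def ennreal_leI)
  also have "\<dots> = ennreal (2 powr \<bar>c - d\<bar> * \<rho> powr (c - d)) * emeasure lborel (cball (0::'a) (2 * \<rho>))"
    by (simp add: nn_integral_cmult_indicator)
  also have "emeasure lborel (cball (0::'a) (2 * \<rho>)) = ennreal (unit_ball_vol d * (2 * \<rho>) powr d)"
    using \<rho> by (simp add: emeasure_cball d_def powr_realpow)
  also have "ennreal (2 powr \<bar>c - d\<bar> * \<rho> powr (c - d)) * ennreal (unit_ball_vol d * (2 * \<rho>) powr d)
      = ennreal (2 powr \<bar>c - d\<bar> * \<rho> powr (c - d) * (unit_ball_vol d * (2 * \<rho>) powr d))"
    by (simp add: d_def flip: ennreal_mult)
  also have "2 powr \<bar>c - d\<bar> * \<rho> powr (c - d) * (unit_ball_vol d * (2 * \<rho>) powr d)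
      = 2 powr \<bar>c - d\<bar> * unit_ball_vol d * 2 powr d * (\<rho> powr (c - d) * \<rho> powr d)"
    using \<rho> by (simp add: powr_mult mult_ac)
  also have "\<rho> powr (c - d) * \<rho> powr d = \<rho> powr c"
    by (simp flip: powr_add)
  finally show ?thesis .
qed

lemma nn_integral_shells_finite:
  fixes A :: "'a::euclidean_space set"
  assumes \<rho>: "\<And>n. \<rho> n > 0" and sum: "summable (\<lambda>n. \<rho> n powr c)" and A: "A \<subseteq> (\<Union>n::nat. shell (\<rho> n))"
  shows "(\<integral>\<^sup>+z. ennreal (norm (z::'a) powr (c - real DIM('a))) * indicator A z \<partial>lborel) < top"
proof -
  define K where "K = 2 powr \<bar>c - real DIM('a)\<bar> * unit_ball_vol (real DIM('a)) * 2 powr real DIM('a)"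
  let ?f = "\<lambda>n z. ennreal (norm (z::'a) powr (c - real DIM('a))) * indicator (shell (\<rho> n)) z"
  have "(\<integral>\<^sup>+z. ennreal (norm (z::'a) powr (c - real DIM('a))) * indicator A z \<partial>lborel)
      \<le> (\<integral>\<^sup>+z. (\<Sum>n. ?f n z) \<partial>lborel)"
  proof (intro nn_integral_mono)
    fix z :: 'a
    show "ennreal (norm (z::'a) powr (c - real DIM('a))) * indicator A z \<le> (\<Sum>n. ?f n z)"
    proof (cases "z \<in> A")
      case True
      then obtain n where "z \<in> shell (\<rho> n)" using A by blast
      then have "ennreal (norm (z::'a) powr (c - real DIM('a))) * indicator A z = (\<Sum>i\<in>{n}. ?f i z)"
        using True by simp
      also have "\<dots> \<le> (\<Sum>n. ?f n z)" by (intro sum_le_suminf) auto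
      finally show ?thesis .
    qed simp
  qed
  also have "\<dots> = (\<Sum>n. \<integral>\<^sup>+z. ?f n z \<partial>lborel)"
    by (intro nn_integral_suminf) measurable
  also have "\<dots> \<le> (\<Sum>n. ennreal (K * \<rho> n powr c))"
    unfolding K_def by (intro suminf_le nn_integral_shell_le \<rho> summableI)
  also have "\<dots> = ennreal (\<Sum>n. K * \<rho> n powr c)"
    by (rule suminf_ennreal2) (use sum in \<open>auto simp: K_def intro: summable_mult\<close>)
  finally show ?thesis by (rule le_less_trans) simp
qed

lemma powr_power_commute:
  fixes x c :: real
  assumes "0 < x"
  shows "(x powr c) ^ n = (x ^ n) powr c"
  using assms by (induction n) (simp_all add: powr_mult)

lemma nn_integral_powr_near_0:
  assumes c: "c > 0"
  shows "(\<integral>\<^sup>+z. ennreal (norm (z::'a::euclidean_space) powr (c - real DIM('a))) * indicator {z. 0 < norm z \<and> norm z \<le> 1} z \<partial>lborel) < top"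
proof (rule nn_integral_shells_finite[where \<rho> = "\<lambda>n. (1/2) ^ Suc n"])
  have "summable (\<lambda>n. ((1/2) powr c) ^ Suc n)"
    using c powr_less_mono2[of c "1/2" 1] by (subst summable_Suc_iff) (simp add: summable_geometric)
  also have "(\<lambda>n. ((1/2) powr c) ^ Suc n) = (\<lambda>n. ((1/2) ^ Suc n) powr c)"
    by (simp only: powr_power_commute zero_less_divide_1_iff zero_less_numeral)
  finally show "summable (\<lambda>n. ((1/2::real) ^ Suc n) powr c)" .
  show "{z::'a. 0 < norm z \<and> norm z \<le> 1} \<subseteq> (\<Union>n. shell ((1/2) ^ Suc n))"
  proof
    fix z :: 'a assume "z \<in> {z. 0 < norm z \<and> norm z \<le> 1}"
    then have z: "0 < norm z" "norm z \<le> 1" by auto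
    define n where "n = (LEAST n. (1/2) ^ Suc n < norm z)"
    have "\<exists>n. (1/2) ^ n < norm z" using z by (intro real_arch_pow_inv) auto
    then obtain n0 where "(1/2) ^ n0 < norm z" by blast
    then have "(1/2) ^ Suc n0 < norm z"
      using norm_ge_zero[of z] unfolding power_Suc by linarith
    then have n: "(1/2) ^ Suc n < norm z" unfolding n_def by (rule LeastI)
    have "norm z \<le> (1/2) ^ n"
    proof (cases n)
      case (Suc k)
      then have "\<not> (1/2) ^ Suc k < norm z" unfolding n_def by (intro not_less_Least) auto
      then show ?thesis using Suc by simp
    qed (use z in auto)
    with n show "z \<in> (\<Union>n. shell ((1/2) ^ Suc n))" by (auto simp: shell_def intro!: exI[of _ n])
  qed
qed simp

lemma nn_integral_powr_at_infinity:
  assumes c: "c < 0"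
  shows "(\<integral>\<^sup>+z. ennreal (norm (z::'a::euclidean_space) powr (c - real DIM('a))) * indicator {z. 1 < norm z} z \<partial>lborel) < top"
proof (rule nn_integral_shells_finite[where \<rho> = "\<lambda>n. 2 ^ n"])
  have "summable (\<lambda>n. (2 powr c) ^ n)"
    using c by (simp add: summable_geometric powr_less_one)
  also have "(\<lambda>n. (2 powr c) ^ n) = (\<lambda>n. (2 ^ n) powr c)"
    by (simp only: powr_power_commute zero_less_numeral)
  finally show "summable (\<lambda>n. (2 ^ n :: real) powr c)" .
  show "{z::'a. 1 < norm z} \<subseteq> (\<Union>n. shell (2 ^ n))"
  proof
    fix z :: 'a assume "z \<in> {z. 1 < norm z}"
    then have z: "1 < norm z" by auto
    define n where "n = (LEAST n. norm z \<le> 2 ^ Suc n)"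
    obtain n0 where "norm z < 2 ^ n0" using real_arch_pow[of 2 "norm z"] by auto
    then have "norm z \<le> 2 ^ Suc n0"
      using norm_ge_zero[of z] by (simp del: norm_ge_zero)
    then have n: "norm z \<le> 2 ^ Suc n" unfolding n_def by (rule LeastI)
    have "2 ^ n < norm z"
    proof (cases n)
      case (Suc k)
      then have "\<not> norm z \<le> 2 ^ Suc k" unfolding n_def by (intro not_less_Least) auto
      then show ?thesis using Suc by simp
    qed (use z in auto)
    with n show "z \<in> (\<Union>n. shell (2 ^ n))" by (auto simp: shell_def)
  qed
qed simp

lemma norm_fourier_transform_le:
  assumes "finite_measure \<mu>" "sets \<mu> = sets borel"
  shows "norm (fourier_transform \<mu> z) \<le> measure \<mu> UNIV"
proof -
  interpret finite_measure \<mu> by fact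
  have "space \<mu> = UNIV" using sets_eq_imp_space_eq[OF assms(2)] by simp
  moreover have "norm (fourier_transform \<mu> z) \<le> (LINT x|\<mu>. norm (wave z x))"
    unfolding fourier_transform_eq_wave by (rule integral_norm_bound)
  ultimately show ?thesis by simp
qed

text \<open>
  Near the origin the transform is bounded by the total mass, and \<open>t > 0\<close> makes the power integrable;
  far from the origin the decay of order \<open>s > t\<close> does.
\<close>

lemma fourier_energy_finite:
  fixes \<mu> :: "'a::euclidean_space measure"
  assumes \<mu>: "finite_measure \<mu>" "sets \<mu> = sets borel"
    and decay: "\<And>z. (norm (fourier_transform \<mu> z))\<^sup>2 * norm z powr s \<le> B"
    and t: "0 < t" "t < s" and \<theta>: "0 < \<theta>"
  shows "fourier_energy t \<theta> \<mu> < top"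
proof -
  let ?h = "\<lambda>z. norm (fourier_transform \<mu> z)" and ?d = "real DIM('a)"
  define M where "M = measure \<mu> UNIV"
  let ?D = "{z::'a. 0 < norm z \<and> norm z \<le> 1}" and ?O = "{z::'a. 1 < norm z}"
  have B: "B \<ge> 0" using decay[of 0] by (simp add: order_trans[rotated])
  have near: "?h z powr (2 / \<theta>) * norm z powr (t / \<theta> - ?d) \<le> M powr (2 / \<theta>) * norm z powr (t / \<theta> - ?d)" for z
    using norm_fourier_transform_le[OF \<mu>, of z] \<theta> unfolding M_def
    by (intro mult_right_mono powr_mono2) auto
  have far: "?h z powr (2 / \<theta>) * norm z powr (t / \<theta> - ?d) \<le> B powr (1 / \<theta>) * norm z powr ((t - s) / \<theta> - ?d)"
    if z: "1 < norm z" for z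
  proof -
    have "(?h z)\<^sup>2 \<le> B * norm z powr (- s)"
      using decay[of z] z by (cases "z = 0") (simp_all add: powr_minus divide_inverse[symmetric] pos_le_divide_eq)
    then have "((?h z)\<^sup>2) powr (1 / \<theta>) \<le> (B * norm z powr (- s)) powr (1 / \<theta>)"
      using \<theta> by (intro powr_mono2) auto
    moreover have "((?h z)\<^sup>2) powr (1 / \<theta>) = ?h z powr (2 / \<theta>)"
    proof (cases "?h z = 0")
      case False
      then have "(?h z)\<^sup>2 = ?h z powr 2" by simp
      then show ?thesis by (simp only: powr_powr) simp
    qed (use \<theta> in auto)
    moreover have "(B * norm z powr (- s)) powr (1 / \<theta>) = B powr (1 / \<theta>) * norm z powr (- s / \<theta>)"
      using B by (simp add: powr_mult powr_powr)
    ultimately have "?h z powr (2 / \<theta>) * norm z powr (t / \<theta> - ?d)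
      \<le> B powr (1 / \<theta>) * norm z powr (- s / \<theta>) * norm z powr (t / \<theta> - ?d)"
      by (intro mult_right_mono) auto
    also have "\<dots> = B powr (1 / \<theta>) * norm z powr ((t - s) / \<theta> - ?d)"
      by (simp add: diff_divide_distrib algebra_simps flip: powr_add)
    finally show ?thesis .
  qed
  have "(\<integral>\<^sup>+ z. ennreal (?h z powr (2 / \<theta>) * norm z powr (t / \<theta> - ?d)) \<partial>lborel)
     \<le> (\<integral>\<^sup>+ z. ennreal (M powr (2 / \<theta>)) * (ennreal (norm z powr (t / \<theta> - ?d)) * indicator ?D z)
          + ennreal (B powr (1 / \<theta>)) * (ennreal (norm z powr ((t - s) / \<theta> - ?d)) * indicator ?O z) \<partial>lborel)"
  proof (intro nn_integral_mono)
    fix z :: 'a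
    consider "z = 0" | "z \<in> ?D" | "z \<in> ?O" by force
    then show "ennreal (?h z powr (2 / \<theta>) * norm z powr (t / \<theta> - ?d))
      \<le> ennreal (M powr (2 / \<theta>)) * (ennreal (norm z powr (t / \<theta> - ?d)) * indicator ?D z)
          + ennreal (B powr (1 / \<theta>)) * (ennreal (norm z powr ((t - s) / \<theta> - ?d)) * indicator ?O z)"
      using near[of z] far[of z] by cases (auto simp flip: ennreal_mult intro: ennreal_leI)
  qed
  also have "\<dots> = ennreal (M powr (2 / \<theta>)) * (\<integral>\<^sup>+ z. ennreal (norm z powr (t / \<theta> - ?d)) * indicator ?D z \<partial>lborel)
      + ennreal (B powr (1 / \<theta>)) * (\<integral>\<^sup>+ z. ennreal (norm z powr ((t - s) / \<theta> - ?d)) * indicator ?O z \<partial>lborel)"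
    by (subst nn_integral_add) (simp_all add: nn_integral_cmult)
  also have "\<dots> < top"
    using nn_integral_powr_near_0[of "t / \<theta>", where 'a = 'a] nn_integral_powr_at_infinity[of "(t - s) / \<theta>", where 'a = 'a] t \<theta>
    by (simp add: ennreal_mult_less_top divide_neg_pos)
  finally show ?thesis
    using \<theta> by (auto simp: fourier_energy_def ennreal_powr_def less_top)
qed

text \<open>
  An exponent that is admissible for \<open>\<theta> = 0\<close> need not be admissible for larger \<open>\<theta>\<close>, but all smaller ones
  are, and the supremum does not see the difference.
\<close>

lemma fourier_spectrum_measure_mono_0:
  fixes \<mu> :: "'a::euclidean_space measure"
  assumes \<mu>: "finite_measure \<mu>" "sets \<mu> = sets borel" and \<theta>: "0 < \<theta>"
  shows "fourier_spectrum_measure 0 \<mu> \<le> fourier_spectrum_measure \<theta> \<mu>"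
  unfolding fourier_spectrum_measure_def[of 0]
proof (intro SUP_least)
  fix s assume "s \<in> {s. 0 \<le> s \<and> fourier_energy s 0 \<mu> < top}"
  then have s: "0 \<le> s" and fin: "fourier_energy s 0 \<mu> < top" by auto
  let ?S = "fourier_spectrum_measure \<theta> \<mu>"
  define B where "B = enn2real (fourier_energy s 0 \<mu>)"
  have le: "ennreal t \<le> ?S" if t: "0 < t" "t < s" for t
  proof -
    have "(norm (fourier_transform \<mu> z))\<^sup>2 * norm z powr s \<le> B" for z
    proof -
      have "ennreal ((norm (fourier_transform \<mu> z))\<^sup>2 * rpow (norm z) s) \<le> fourier_energy s 0 \<mu>"
        unfolding fourier_energy_def by (auto intro: SUP_upper)
      also have "\<dots> = ennreal B" using fin by (simp add: B_def)
      finally show ?thesis using t by (simp add: rpow_def B_def)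
    qed
    then have "fourier_energy t \<theta> \<mu> < top"
      using fourier_energy_finite[OF \<mu> _ t \<theta>] by blast
    then show ?thesis unfolding fourier_spectrum_measure_def using t by (intro SUP_upper) auto
  qed
  show "ennreal s \<le> ?S"
  proof (rule ccontr)
    assume "\<not> ?thesis"
    then have less: "?S < ennreal s" by simp
    then obtain q where q: "?S = ennreal q" "0 \<le> q" by (cases ?S) auto
    with less have "q < s" by (simp add: ennreal_less_iff)
    then have "ennreal ((q + s) / 2) \<le> ennreal q" using le[of "(q + s) / 2"] q by simp
    with q \<open>q < s\<close> show False by simp
  qed
qed

lemma fourier_dim_le_fourier_spectrum:
  fixes E :: "'a::euclidean_space set"
  assumes "0 \<le> \<theta>"
  shows "fourier_dim E \<le> fourier_spectrum \<theta> E"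
proof (cases "\<theta> = 0")
  case False
  then show ?thesis
    unfolding fourier_dim_def fourier_spectrum_def using assms
  proof (intro SUP_mono)
    fix \<mu> :: "'a measure" assume \<mu>: "\<mu> \<in> measures_on E"
    then have "fourier_spectrum_measure 0 \<mu> \<le> fourier_spectrum_measure \<theta> \<mu>"
      using False assms by (intro fourier_spectrum_measure_mono_0) (auto simp: measures_on_def)
    then show "\<exists>\<nu>\<in>measures_on E. min (fourier_spectrum_measure 0 \<mu>) (of_nat DIM('a))
        \<le> min (fourier_spectrum_measure \<theta> \<nu>) (of_nat DIM('a))"
      using \<mu> by (intro bexI[of _ \<mu>] min.mono) auto
  qed
qed (simp add: fourier_dim_def)

section \<open>Covers and Hausdorff dimension\<close>

text \<open>
  A cover by sets of diameter at most \<open>\<delta>\<close> controls the premeasure at \<open>\<delta>\<close>, so a sequence of radii tending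
  to 0 is enough, however sparse it is.
\<close>

lemma hausdorff_dim_le_of_covers:
  fixes A :: "'a::euclidean_space set"
  assumes u: "u > 0"
    and cover: "\<And>e. e > 0 \<Longrightarrow> \<exists>F l. finite F \<and> A \<subseteq> (\<Union>c\<in>F. cball c l) \<and> 0 \<le> l \<and> l \<le> e
                   \<and> card F * (2 * l) powr u \<le> e"
  shows "hausdorff_dim A \<le> ennreal u"
proof -
  have "hausdorff_premeasure u \<delta> A \<le> ennreal e" if \<delta>: "\<delta> > 0" and e: "e > 0" for \<delta> e
  proof -
    obtain F l where F: "finite F" "A \<subseteq> (\<Union>c\<in>F. cball c l)" and l: "0 \<le> l" "l \<le> min e (\<delta> / 2)"
      and card: "card F * (2 * l) powr u \<le> min e (\<delta> / 2)"
      using cover[of "min e (\<delta> / 2)"] \<delta> e by auto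
    obtain h where h: "bij_betw h {0..<card F} F" using ex_bij_betw_nat_finite[OF F(1)] by blast
    define U where "U i = (if i < card F then cball (h i) l else {})" for i
    have "A \<subseteq> (\<Union>i. U i)"
    proof
      fix a assume "a \<in> A"
      then obtain c where c: "c \<in> F" "a \<in> cball c l" using F by blast
      then obtain i where "i < card F" "h i = c" using h unfolding bij_betw_def by (metis imageE atLeastLessThan_iff)
      then show "a \<in> (\<Union>i. U i)" using c by (auto simp: U_def intro!: exI[of _ i])
    qed
    moreover have "bounded (U i) \<and> diameter (U i) \<le> \<delta>" for i
      using l \<delta> by (auto simp: U_def)
    ultimately have "hausdorff_premeasure u \<delta> A \<le> (\<Sum>i. diam_pow u (U i))"
      unfolding hausdorff_premeasure_def by (intro Inf_lower) auto
    also have "\<dots> = (\<Sum>i<card F. diam_pow u (U i))"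
      by (intro suminf_finite) (auto simp: U_def diam_pow_def)
    also have "\<dots> = (\<Sum>i<card F. ennreal ((2 * l) powr u))"
      using l u by (intro sum.cong) (auto simp: U_def diam_pow_def rpow_def)
    also have "\<dots> = ennreal (card F * (2 * l) powr u)"
      by (simp add: ennreal_mult ennreal_of_nat_eq_real_of_nat)
    also have "\<dots> \<le> ennreal e" using card by (intro ennreal_leI) simp
    finally show ?thesis .
  qed
  then have "hausdorff_premeasure u \<delta> A = 0" if "\<delta> > 0" for \<delta>
  proof -
    have "hausdorff_premeasure u \<delta> A \<le> 0"
      by (rule ennreal_le_epsilon) (use \<open>\<And>\<delta> e. \<delta> > 0 \<Longrightarrow> e > 0 \<Longrightarrow> hausdorff_premeasure u \<delta> A \<le> ennreal e\<close> that in simp)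
    then show ?thesis by simp
  qed
  then have "hausdorff_measure u A = 0"
    unfolding hausdorff_measure_def by (simp cong: SUP_cong_simp)
  then show ?thesis unfolding hausdorff_dim_def using u by (intro Inf_lower) auto
qed

section \<open>The sparse Cantor set\<close>

text \<open>
  The second inequality closes the induction that counts points: at most \<open>T k powr t\<close> points before
  stage \<open>k\<close>, times \<open>2 * T (Suc k) powr (t - \<epsilon>)\<close> at stage \<open>k\<close>, make at most \<open>T (Suc k) powr t\<close>.
\<close>

lemma exists_scales:
  fixes t \<epsilon> :: real
  assumes \<epsilon>: "0 < \<epsilon>" and G: "\<forall>\<^sub>F T in at_top. G (T::real)"
  shows "\<exists>T. T 0 = 1 \<and> (\<forall>k::nat. 2 * T k \<le> T (Suc k) \<and> 2 * T k powr t \<le> T (Suc k) powr \<epsilon> \<and> G (T (Suc k)))"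
proof -
  have "\<exists>T'. 2 * T \<le> T' \<and> 2 * T powr t \<le> T' powr \<epsilon> \<and> G T'" for T :: real
  proof -
    have "filterlim (\<lambda>T'::real. T' powr \<epsilon>) at_top at_top"
      using \<epsilon> by real_asymp
    then have "\<forall>\<^sub>F T' in at_top. 2 * T powr t \<le> T' powr \<epsilon>"
      by (simp add: filterlim_at_top)
    then have "\<forall>\<^sub>F T' in at_top. 2 * T \<le> T' \<and> 2 * T powr t \<le> T' powr \<epsilon> \<and> G T'"
      using G eventually_ge_at_top[of "2 * T"] by eventually_elim auto
    then show ?thesis by (rule eventually_happens'[rotated]) simp
  qed
  then have "\<exists>T. \<forall>n. (n = 0 \<longrightarrow> T n = 1) \<and>
      (2 * T n \<le> T (Suc n) \<and> 2 * T n powr t \<le> T (Suc n) powr \<epsilon> \<and> G (T (Suc n)))"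
    by (intro dependent_nat_choice) auto
  then obtain T where "\<forall>n. (n = 0 \<longrightarrow> T n = 1) \<and>
      (2 * T n \<le> T (Suc n) \<and> 2 * T n powr t \<le> T (Suc n) powr \<epsilon> \<and> G (T (Suc n)))" ..
  then show ?thesis by (intro exI[of _ T]) auto
qed

text \<open>
  The exponents satisfy \<open>s < a * s < c < t < 1/2\<close> and \<open>a > 1\<close>. There are about \<open>T (Suc k) powr c\<close>
  points at stage \<open>k\<close>, so their sampling error is below \<open>T (Suc k) powr (- a * s / 2)\<close>, as required at
  the frequencies up to \<open>T (Suc k) powr a\<close>. The product of the numbers of points before stage \<open>k\<close>
  is at most \<open>T k powr t\<close>.
\<close>

lemma exists_closed_set_fourier_dim_ge:
  fixes s :: real
  assumes s: "0 < s" "s < 1/2"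
  shows "\<exists>E :: 'a::euclidean_space set. closed E \<and> hausdorff_dim (distance_set E) < 1 \<and> fourier_dim E \<ge> ennreal s"
proof -
  define c where "c = (s + 1/2) / 2"
  define t where "t = (c + 1/2) / 2"
  define a where "a = (1 + c / s) / 2"
  define b where "b = a * s / 2"
  \<comment> \<open>For \<open>norm z \<ge> T k powr a\<close> the rescaled frequency \<open>z / T k\<close> has norm at least
    \<open>norm z powr (1 - 1 / a)\<close>. The order \<open>m\<close> is such that decay of order \<open>m\<close> there is decay of
    order at least 1 in \<open>z\<close>.\<close>
  define m where "m = nat \<lceil>a / (a - 1)\<rceil>"
  have c: "s < c" "c < 1/2" "0 < c" using s by (auto simp: c_def)
  have t: "c < t" "t < 1/2" "0 < t" using c by (auto simp: t_def)
  have cs: "c / s > 1" using c s by simp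
  then have a: "a > 1" by (simp add: a_def)
  have "(1 + q) / 2 < q" if "q > 1" for q :: real using that by simp
  from this[OF cs] have "a < c / s" by (simp only: a_def)
  then have b: "0 < b" "2 * b < c" using s a by (auto simp: b_def pos_less_divide_eq)
  have "a / (a - 1) > 1" using a by simp
  then have m: "m \<ge> 1" "a / (a - 1) \<le> m" unfolding m_def by linarith+
  have ma: "m * (1 - 1 / a) \<ge> 1"
    using m(2) a by (simp add: field_simps)

  define G where "G C T y \<longleftrightarrow> (\<forall>j<nat \<lceil>T powr c\<rceil>. norm (y j :: 'a) \<le> 1) \<and>
     (\<forall>z. z \<noteq> 0 \<longrightarrow> norm z \<le> T powr a \<longrightarrow>
        norm ((\<Sum>j<nat \<lceil>T powr c\<rceil>. wave z (y j)) / of_nat (nat \<lceil>T powr c\<rceil>))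
          \<le> (C / norm z) ^ m + T powr (- b))" for C T y
  have "\<exists>C\<ge>0. \<forall>\<^sub>F T in at_top. \<exists>y. G C T y"
    unfolding G_def by (rule exists_decaying_sample) (use m a b in auto)
  then obtain C where C: "C \<ge> 0" and ev: "\<forall>\<^sub>F T in at_top. \<exists>y. G C T y" by blast
  obtain T where T0: "T 0 = 1" and T2: "\<And>k. 2 * T k \<le> T (Suc k)"
    and Tt: "\<And>k. 2 * T k powr t \<le> T (Suc k) powr (t - c)" and TG: "\<And>k. \<exists>y. G C (T (Suc k)) y"
    using exists_scales[of "t - c", OF _ ev, of t] t by auto
  obtain y where y: "\<And>k. G C (T (Suc k)) (y k)" using TG by metis

  have T_mono: "2 ^ i * T k \<le> T (k + i)" for i k
  proof (induction i)
    case (Suc i)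
    then show ?case using T2[of "k + i"] by simp
  qed simp
  have T_ge: "2 ^ k \<le> T k" for k using T_mono[of k 0] T0 by simp
  have T1: "1 \<le> T k" for k using T_ge[of k] one_le_power[of "2::real" k] by linarith
  have T_pos: "0 < T k" for k using T1[of k] by linarith

  define N where "N k = nat \<lceil>T (Suc k) powr c\<rceil>" for k
  define x where "x k j = (1 / T k) *\<^sub>R y k j" for k j
  have Tc1: "1 \<le> T k powr c" for k using T1 c by (simp add: ge_one_powr_ge_zero)
  have N: "0 < N k" "N k \<le> 2 * T (Suc k) powr c" for k
    using Tc1[of "Suc k"] unfolding N_def by linarith+
  have sum_geo: "summable (\<lambda>i. (1/2) ^ i / T k)" "(\<Sum>i. (1/2) ^ i / T k) = 2 / T k" for k
    by (auto simp: suminf_divide suminf_geometric summable_divide summable_geometric)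
  have inv_le: "1 / T (i + k) \<le> (1/2) ^ i / T k" for i k
    using T_mono[of i k] T_pos[of k] T_pos[of "i + k"]
    by (simp add: field_simps power_one_over add.commute)
  have summable_T: "summable (\<lambda>i. 1 / T i)"
    by (rule summable_comparison_test'[OF sum_geo(1)[of 0]]) (use inv_le[of _ 0] T_pos in \<open>auto simp: less_imp_le\<close>)

  interpret random_series N x "\<lambda>k. 1 / T k"
  proof
    fix k j assume "j < N k"
    then have "norm (y k j) \<le> 1" using y[of k] unfolding G_def N_def by blast
    then show "norm (x k j) \<le> 1 / T k"
      using T_pos[of k] by (simp add: x_def divide_right_mono)
  qed (use N summable_T in auto)

  have tail_le: "tail k \<le> 2 / T k" for k
    unfolding tail_def sum_geo(2)[symmetric]
    by (intro suminf_le inv_le sum_geo) (use summable_T in \<open>simp add: summable_iff_shift[of "\<lambda>i. 1 / T i"]\<close>)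

  have card_le: "real (\<Prod>i<k. N i) \<le> T k powr t" for k
  proof (induction k)
    case 0
    then show ?case by (simp add: T0)
  next
    case (Suc k)
    have "real (\<Prod>i<Suc k. N i) = (\<Prod>i<k. N i) * real (N k)" by simp
    also have "\<dots> \<le> T k powr t * (2 * T (Suc k) powr c)"
      using Suc N(2) by (intro mult_mono) auto
    also have "\<dots> = (2 * T k powr t) * T (Suc k) powr c" by simp
    also have "\<dots> \<le> T (Suc k) powr (t - c) * T (Suc k) powr c"
      by (intro mult_right_mono Tt) auto
    also have "\<dots> = T (Suc k) powr t" by (simp flip: powr_add)
    finally show ?case .
  qed

  \<comment> \<open>Any exponent strictly between \<open>2 * t\<close> and 1 would do.\<close>
  have "hausdorff_dim (distance_set cantor_set) \<le> ennreal (t + 1/2)"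
  proof (rule hausdorff_dim_le_of_covers)
    fix e :: real assume e: "e > 0"
    have "((\<lambda>T::real. 4 / T) \<longlongrightarrow> 0) at_top" by real_asymp
    moreover have "((\<lambda>T::real. T powr (2 * t) * (8 / T) powr (t + 1/2)) \<longlongrightarrow> 0) at_top"
      using t by real_asymp
    ultimately have "\<forall>\<^sub>F T in at_top. 4 / T < e \<and> T powr (2 * t) * (8 / T) powr (t + 1/2) < e"
      using e by (intro eventually_conj order_tendstoD)
    moreover have "filterlim T at_top sequentially"
    proof (rule filterlim_at_top_mono)
      show "filterlim (\<lambda>k. 2 ^ k :: real) at_top sequentially" by real_asymp
    qed (use T_ge in auto)
    ultimately have "\<forall>\<^sub>F k in sequentially. 4 / T k < e \<and> T k powr (2 * t) * (8 / T k) powr (t + 1/2) < e"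
      by (rule eventually_compose_filterlim)
    then obtain k where k: "4 / T k < e" "T k powr (2 * t) * (8 / T k) powr (t + 1/2) < e"
      using eventually_happens'[OF sequentially_bot] by blast
    obtain F where F: "finite F" "card F \<le> (\<Prod>i<k. N i)\<^sup>2"
      and cover: "distance_set cantor_set \<subseteq> (\<Union>c\<in>F. cball c (2 * tail k))"
      using distance_set_cantor_set_cover[of k] by blast
    have "real (card F) \<le> (real (\<Prod>i<k. N i))\<^sup>2" using F(2) by (metis of_nat_le_iff of_nat_power)
    also have "\<dots> \<le> (T k powr t)\<^sup>2" by (intro power_mono card_le) (simp add: prod_nonneg)
    also have "\<dots> = T k powr (2 * t)" using T_pos[of k] by (simp add: powr_powr mult.commute flip: powr_numeral)
    finally have "card F * (8 / T k) powr (t + 1/2) \<le> T k powr (2 * t) * (8 / T k) powr (t + 1/2)"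
      by (intro mult_right_mono) auto
    then have "card F * (2 * (4 / T k)) powr (t + 1/2) \<le> e" using k(2) by simp
    moreover have "distance_set cantor_set \<subseteq> (\<Union>c\<in>F. cball c (4 / T k))"
    proof -
      have "2 * tail k \<le> 4 / T k" using tail_le[of k] by simp
      then have "cball c (2 * tail k) \<subseteq> cball c (4 / T k)" for c :: real by (rule subset_cball)
      with cover show ?thesis by blast
    qed
    ultimately show "\<exists>F l. finite F \<and> distance_set cantor_set \<subseteq> (\<Union>c\<in>F. cball c l) \<and> 0 \<le> l \<and> l \<le> e
                   \<and> card F * (2 * l) powr (t + 1/2) \<le> e"
      using F(1) k(1) T_pos[of k] by (intro exI[of _ F] exI[of _ "4 / T k"] conjI) auto
  qed (use t in simp)
  also have "ennreal (t + 1/2) < 1"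
    using t unfolding ennreal_1[symmetric] by (intro ennreal_lessI) auto
  finally have dim: "hausdorff_dim (distance_set cantor_set) < 1" .

  have decay: "norm (fourier_transform law z) \<le> (C ^ m + 1) * norm z powr (- (s / 2))" if z: "norm z \<ge> 1" for z
  proof -
    \<comment> \<open>The factor responsible for the frequency \<open>z\<close>. As \<open>T 0 = 1\<close>, the ranges of the factors exhaust all
      frequencies of norm at least 1.\<close>
    define k where "k = (LEAST k. norm z \<le> T (Suc k) powr a)"
    have "\<exists>k. norm z \<le> T (Suc k) powr a"
    proof -
      obtain k where "norm z < 2 ^ k" using real_arch_pow[of 2 "norm z"] by auto
      also have "2 ^ k \<le> T (Suc k)" using T_ge[of k] T2[of k] T_pos[of k] by linarith
      also have "\<dots> \<le> T (Suc k) powr a" using powr_mono[of 1 a "T (Suc k)"] T1[of "Suc k"] a by simp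
      finally show ?thesis by (intro exI[of _ k]) simp
    qed
    then have upper: "norm z \<le> T (Suc k) powr a" unfolding k_def by (rule LeastI_ex)
    have lower: "T k powr a \<le> norm z"
    proof (cases k)
      case 0
      then show ?thesis using z by (simp add: T0)
    next
      case (Suc j)
      then have "\<not> norm z \<le> T (Suc j) powr a" unfolding k_def by (intro not_less_Least) auto
      then show ?thesis using Suc by simp
    qed
    let ?w = "(1 / T k) *\<^sub>R z"
    have z0: "z \<noteq> 0" using z by auto
    have w0: "?w \<noteq> 0" using z0 T_pos[of k] by simp
    have "norm ?w = norm z / T k" using T_pos[of k] by simp
    also have "\<dots> \<le> norm z" using T1[of k] by (simp add: divide_le_eq mult_le_cancel_left1)
    also note upper
    finally have w: "norm ?w \<le> T (Suc k) powr a" .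
    have "norm (fourier_transform law z) \<le> norm ((\<Sum>j<N k. wave z (x k j)) / of_nat (N k))"
      by (rule norm_fourier_transform_law_le)
    also have "\<dots> = norm ((\<Sum>j<N k. wave ?w (y k j)) / of_nat (N k))"
      by (simp add: x_def wave_scaleR)
    also have "\<dots> \<le> (C / norm ?w) ^ m + T (Suc k) powr (- b)"
      using y[of k] w0 w unfolding G_def N_def by blast
    also have "(C / norm ?w) ^ m \<le> C ^ m * norm z powr (- (s / 2))"
    proof -
      have "T k = (T k powr a) powr (1 / a)" using a T_pos[of k] by (simp add: powr_powr)
      also have "\<dots> \<le> norm z powr (1 / a)" using lower a by (intro powr_mono2) auto
      finally have "T k / norm z \<le> norm z powr (1 / a) / norm z" by (intro divide_right_mono) auto
      also have "\<dots> = norm z powr (- (1 - 1 / a))" using z0 by (simp add: powr_diff)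
      finally have "(T k / norm z) ^ m \<le> (norm z powr (- (1 - 1 / a))) ^ m"
        using T_pos[of k] by (intro power_mono) auto
      also have "\<dots> = norm z powr (- (m * (1 - 1 / a)))" using z0 by (simp add: powr_power algebra_simps)
      also have "\<dots> \<le> norm z powr (- (s / 2))"
        using z ma s by (intro powr_mono) auto
      finally have "C ^ m * (T k / norm z) ^ m \<le> C ^ m * norm z powr (- (s / 2))"
        using C by (intro mult_left_mono) auto
      moreover have "C / norm ?w = C * (T k / norm z)" using T_pos[of k] by simp
      ultimately show ?thesis by (simp only: power_mult_distrib)
    qed
    also have "T (Suc k) powr (- b) \<le> norm z powr (- (s / 2))"
    proof -
      have "T (Suc k) powr (- b) = (T (Suc k) powr a) powr (- (s / 2))"
        by (simp add: powr_powr b_def)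
      also have "\<dots> \<le> norm z powr (- (s / 2))"
        using upper z0 s by (intro powr_mono2') auto
      finally show ?thesis .
    qed
    finally show ?thesis by (simp add: algebra_simps)
  qed

  interpret law: prob_space law by (rule prob_space_law)
  have energy: "(norm (fourier_transform law z))\<^sup>2 * norm z powr s \<le> (C ^ m + 1)\<^sup>2" for z
  proof (cases "norm z \<ge> 1")
    case True
    have "(norm (fourier_transform law z))\<^sup>2 \<le> ((C ^ m + 1) * norm z powr (- (s / 2)))\<^sup>2"
      by (intro power_mono decay True) simp
    also have "\<dots> = (C ^ m + 1)\<^sup>2 * norm z powr (- s)"
      by (simp add: power_mult_distrib power2_eq_square flip: powr_add)
    finally have "(norm (fourier_transform law z))\<^sup>2 * norm z powr s
        \<le> (C ^ m + 1)\<^sup>2 * norm z powr (- s) * norm z powr s"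
      by (intro mult_right_mono) auto
    also have "\<dots> = (C ^ m + 1)\<^sup>2 * (norm z powr (- s) * norm z powr s)" by (simp only: mult.assoc)
    also have "norm z powr (- s) * norm z powr s = 1"
      using True by (simp flip: powr_add) auto
    finally show ?thesis by simp
  next
    case False
    have "norm (fourier_transform law z) \<le> 1"
      unfolding fourier_transform_eq_wave by (rule law.norm_expectation_wave_le_1)
    then have "(norm (fourier_transform law z))\<^sup>2 * norm z powr s \<le> 1 * 1"
      using False s by (intro mult_mono power_le_one powr_le1) auto
    also have "\<dots> \<le> (C ^ m + 1)\<^sup>2" using C by (simp add: one_le_power)
    finally show ?thesis .
  qed
  have "fourier_energy s 0 law \<le> ennreal ((C ^ m + 1)\<^sup>2)"
    unfolding fourier_energy_def using s by (auto simp: rpow_def intro!: SUP_least ennreal_leI energy)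
  then have "fourier_energy s 0 law < top" by (rule le_less_trans) simp
  then have "ennreal s \<le> fourier_spectrum_measure 0 law"
    unfolding fourier_spectrum_measure_def using s by (intro SUP_upper) auto
  moreover have "ennreal s \<le> of_nat DIM('a)"
  proof -
    have "s \<le> real DIM('a)" using s DIM_positive[where 'a = 'a] by linarith
    then show ?thesis by (simp add: ennreal_of_nat_eq_real_of_nat ennreal_leI)
  qed
  ultimately have "ennreal s \<le> min (fourier_spectrum_measure 0 law) (of_nat DIM('a))" by simp
  also have "\<dots> \<le> fourier_dim cantor_set"
    unfolding fourier_dim_def fourier_spectrum_def by (intro SUP_upper law_in_measures_on)
  finally show ?thesis using closed_cantor_set dim by blast
qed

theorem proposition3p4:
  fixes s :: real
  assumes "CARD('n::finite) \<ge> 2"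
    and "0 < s" and "s < 1/2"
  shows "\<exists>E :: (real ^ 'n) set. E \<in> sets borel
           \<and> hausdorff_dim (distance_set E) < 1
           \<and> (\<forall>\<theta>\<in>{0..1}. fourier_spectrum \<theta> E \<ge> fourier_dim E \<and> fourier_dim E \<ge> ennreal s)"
proof -
  obtain E :: "(real ^ 'n) set" where "closed E" "hausdorff_dim (distance_set E) < 1" "fourier_dim E \<ge> ennreal s"
    using exists_closed_set_fourier_dim_ge[OF assms(2,3), where 'a = "real ^ 'n"] by blast
  then show ?thesis
    using fourier_dim_le_fourier_spectrum[of _ E] by (intro exI[of _ E]) auto
qed

end
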